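(* Let $f,g:\Sigma_{\mathbf A}^+\to\mathbb{R}$ be Hölder continuous. If $(\Sigma_{\mathbf A}^+,\sigma_{\mathbf A},\mu_f)$ and $(\Sigma_{\mathbf A}^+,\sigma_{\mathbf A},\mu_g)$ are isomorphic, then $\mathcal{E}^{(\mu_f)}=\mathcal{E}^{(\mu_g)}$ as functions on $\mathbb{R}$.
   Context: Let $N\ge 2$ be an integer and $\mathbf A$ an $N\times N$ zero-one matrix that is aperiodic (some power $\mathbf A^k$, $k\ge1$, has all entries positive). $\Sigma_{\mathbf A}^+=\{\omega=(\omega_n)_{n\ge 0}\in\{1,\dots,N\}^{\mathbb{N}\cup\{0\}}:\mathbf A(\omega_n\omega_{n+1})=1 \text{ for all } n\ge 0\}$ (here $\mathbf A(ij)=\mathbf A_{ij}$), with metric $d(\omega,\omega')=\sum_{n\ge0}|\omega_n-\omega'_n|/2^n$; $\sigma_{\mathbf A}$ is the shift $(\sigma_{\mathbf A}\omega)_n=\omega_{n+1}$. Cylinders: for $n\ge 1$, $C_n(\omega)=\{\omega'\in\Sigma_{\mathbf A}^+:\omega'_k=\omega_k,\ 0\le k\le n-1\}$; $C_0(\omega)=\Sigma_{\mathbf A}^+$. Gibbs measures: a $\sigma_{\mathbf A}$-invariant Borel probability measure $\mu$ is a Gibbs measure for a continuous $f:\Sigma_{\mathbf A}^+\to\mathbb{R}$ if there are $C>0$, $P\in\mathbb{R}$ with $C^{-1}\le \mu(C_n(\omega))/\exp(-nP+\sum_{k=0}^{n-1}f(\sigma_{\mathbf A}^k\omega))\le C$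 for all $\omega\in\Sigma_{\mathbf A}^+$, $n\ge1$. Each Hölder continuous $f:\Sigma_{\mathbf A}^+\to\mathbb{R}$ has a unique Gibbs measure, denoted $\mu_f$. Entropy spectrum: for a $\sigma_{\mathbf A}$-invariant Borel probability measure $\mu$ and $\alpha\in\mathbb{R}$, $E_\alpha^{(\mu)}=\{\omega\in\Sigma_{\mathbf A}^+:\lim_{n\to\infty}-\frac1n\log\mu(C_n(\omega))=\alpha\}$ and $\mathcal{E}^{(\mu)}(\alpha)=h(\sigma_{\mathbf A}|E_\alpha^{(\mu)})$. Here $h(\sigma_{\mathbf A}|Z)$ is the topological entropy of the (not necessarily compact or invariant) subset $Z$ in Bowen's sense: the infimum of all $s\ge0$ such that $\lim_{n\to\infty}\inf\sum_i e^{-s n_i}=0$, the infimum being over countable covers of $Z$ by cylinders $C_{n_i}(\omega^{(i)})$ with all $n_i\ge n$; in particular $h(\sigma_{\mathbf A}|\emptyset)=0$. Isomorphic: $(\Sigma_{\mathbf A}^+,\sigma_{\mathbf A},\mu_f)$ and $(\Sigma_{\mathbf A}^+,\sigma_{\mathbf A},\mu_g)$ are isomorphic if there exist Borel sets $X,Y\subset\Sigma_{\mathbf A}^+$ and a bijection $\Phi:X\to Y$ such that: $\sigma_{\mathbf A}(X)\subset X$, $\sigma_{\mathbf A}(Y)\subset Y$, $\mu_f(X)=\mu_g(Y)=1$; $\Phi$ and $\Phi^{-1}$ are Borel measurable; $\Phi\circ\sigma_{\mathbf A}=\sigma_{\mathbf A}\circ\Phi$ on $X$; and $\mu_f=\mu_g\circ\Phi$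 (i.e. $\mu_f(B)=\mu_g(\Phi(B))$ for Borel $B\subset X$). *)

theory Defs
  imports "HOL-Analysis.Analysis" "HOL-Probability.Probability" "Jordan_Normal_Form.Matrix"
begin

definition zero_one_mat :: "nat mat \<Rightarrow> bool" where
  "zero_one_mat A \<longleftrightarrow> elements_mat A \<subseteq> {0, 1}"

definition aperiodic_mat :: "nat mat \<Rightarrow> bool" where
  "aperiodic_mat A \<longleftrightarrow>
     (\<exists>k\<ge>1. \<forall>i<dim_row A. \<forall>j<dim_col A. (A ^\<^sub>m k) $$ (i, j) > 0)"

(* The symbols are 1, ..., N, while matrix indices run from 0 to N - 1. *)
definition subshift :: "nat mat \<Rightarrow> (nat \<Rightarrow> nat) set" where
  "subshift A =
     {\<omega>. \<forall>n. \<omega> n \<in> {1..dim_row A} \<and> A $$ (\<omega> n - 1, \<omega> (Suc n) - 1) = 1}"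

definition shift :: "(nat \<Rightarrow> nat) \<Rightarrow> (nat \<Rightarrow> nat)" where
  "shift \<omega> = (\<lambda>n. \<omega> (Suc n))"

(* The unordered sum agrees with the series, since the terms are nonnegative. It is used because
   it is 0 if the series diverges, so that d is nonnegative also off the shift space, as
   Metric_space demands. *)
definition seq_dist :: "(nat \<Rightarrow> nat) \<Rightarrow> (nat \<Rightarrow> nat) \<Rightarrow> real" where
  "seq_dist \<omega> \<omega>' = (\<Sum>\<^sub>\<infinity>n. \<bar>real (\<omega> n) - real (\<omega>' n)\<bar> / 2 ^ n)"

lemma seq_dist_summable:
  assumes "\<omega> \<in> subshift A" "\<omega>' \<in> subshift A"
  shows "(\<lambda>n. \<bar>real (\<omega> n) - real (\<omega>' n)\<bar> / 2 ^ n) summable_on UNIV"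
proof (rule norm_summable_imp_summable_on, rule summable_comparison_test)
  have "\<bar>real (\<omega> n) - real (\<omega>' n)\<bar> \<le> real (dim_row A)" for n
  proof -
    have "\<omega> n \<le> dim_row A" "\<omega>' n \<le> dim_row A"
      using assms by (auto simp: subshift_def)
    then show ?thesis by linarith
  qed
  then show "\<exists>M. \<forall>n\<ge>M. norm (norm (\<bar>real (\<omega> n) - real (\<omega>' n)\<bar> / 2 ^ n))
      \<le> real (dim_row A) * (1 / 2) ^ n"
    by (auto simp: power_one_over divide_right_mono field_simps)
  show "summable (\<lambda>n. real (dim_row A) * (1 / 2 :: real) ^ n)"
    by (intro summable_mult summable_geometric) simp
qed

lemma Metric_space_subshift: "Metric_space (subshift A) seq_dist"
proof
  fix x y
  show "0 \<le> seq_dist x y"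
    unfolding seq_dist_def by (rule infsum_nonneg) simp
  show "seq_dist x y = seq_dist y x"
    by (simp add: seq_dist_def abs_minus_commute)
next
  fix x y assume xy: "x \<in> subshift A" "y \<in> subshift A"
  show "seq_dist x y = 0 \<longleftrightarrow> x = y"
  proof
    assume 0: "seq_dist x y = 0"
    have "\<bar>real (x n) - real (y n)\<bar> / 2 ^ n = 0" for n
      by (rule nonneg_infsum_le_0D[OF _ seq_dist_summable[OF xy]])
        (use 0 in \<open>auto simp: seq_dist_def\<close>)
    then show "x = y" by (auto simp: fun_eq_iff)
  qed (simp add: seq_dist_def)
next
  fix x y z assume xyz: "x \<in> subshift A" "y \<in> subshift A" "z \<in> subshift A"
  note summ = seq_dist_summable[OF xyz(1,2)] seq_dist_summable[OF xyz(2,3)]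
  have "seq_dist x z \<le>
      (\<Sum>\<^sub>\<infinity>n. \<bar>real (x n) - real (y n)\<bar> / 2 ^ n + \<bar>real (y n) - real (z n)\<bar> / 2 ^ n)"
    unfolding seq_dist_def
    by (rule infsum_mono[OF seq_dist_summable[OF xyz(1,3)] summable_on_add[OF summ]])
      (auto simp: add_divide_distrib[symmetric] intro!: divide_right_mono)
  also have "\<dots> = seq_dist x y + seq_dist y z"
    unfolding seq_dist_def by (rule infsum_add[OF summ])
  finally show "seq_dist x z \<le> seq_dist x y + seq_dist y z" .
qed

definition subshift_topology :: "nat mat \<Rightarrow> (nat \<Rightarrow> nat) topology" where
  "subshift_topology A = Metric_space.mtopology (subshift A) seq_dist"

definition subshift_borel :: "nat mat \<Rightarrow> (nat \<Rightarrow> nat) measure" where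
  "subshift_borel A = sigma (subshift A) {U. openin (subshift_topology A) U}"

lemma sets_subshift_borel:
  "sets (subshift_borel A) = sigma_sets (subshift A) {U. openin (subshift_topology A) U}"
proof -
  have "topspace (subshift_topology A) = subshift A"
    unfolding subshift_topology_def
    by (rule Metric_space.topspace_mtopology[OF Metric_space_subshift])
  then have "{U. openin (subshift_topology A) U} \<subseteq> Pow (subshift A)"
    using openin_subset by fastforce
  then show ?thesis by (simp add: subshift_borel_def sets_measure_of)
qed

lemma space_subshift_borel: "space (subshift_borel A) = subshift A"
  by (simp add: subshift_borel_def space_measure_of_conv)

(* Functions on the shift space are total functions of which only the values on it matter. *)
definition holder_continuous :: "nat mat \<Rightarrow> ((nat \<Rightarrow> nat) \<Rightarrow> real) \<Rightarrow> bool" where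
  "holder_continuous A f \<longleftrightarrow>
     (\<exists>L \<theta>. 0 \<le> L \<and> 0 < \<theta> \<and> \<theta> \<le> 1 \<and>
       (\<forall>\<omega>\<in>subshift A. \<forall>\<omega>'\<in>subshift A. \<bar>f \<omega> - f \<omega>'\<bar> \<le> L * seq_dist \<omega> \<omega>' powr \<theta>))"

definition cylinder :: "nat mat \<Rightarrow> nat \<Rightarrow> (nat \<Rightarrow> nat) \<Rightarrow> (nat \<Rightarrow> nat) set" where
  "cylinder A n \<omega> = {\<omega>' \<in> subshift A. \<forall>k<n. \<omega>' k = \<omega> k}"

definition invariant_prob :: "nat mat \<Rightarrow> (nat \<Rightarrow> nat) measure \<Rightarrow> bool" where
  "invariant_prob A \<mu> \<longleftrightarrow>
     prob_space \<mu> \<and> sets \<mu> = sets (subshift_borel A) \<and>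
     (\<forall>B\<in>sets \<mu>. measure \<mu> (shift -` B \<inter> subshift A) = measure \<mu> B)"

definition gibbs_measure ::
    "nat mat \<Rightarrow> ((nat \<Rightarrow> nat) \<Rightarrow> real) \<Rightarrow> (nat \<Rightarrow> nat) measure \<Rightarrow> bool" where
  "gibbs_measure A f \<mu> \<longleftrightarrow>
     continuous_map (subshift_topology A) euclideanreal f \<and> invariant_prob A \<mu> \<and>
     (\<exists>C>0. \<exists>P. \<forall>\<omega>\<in>subshift A. \<forall>n\<ge>1.
        (let r = measure \<mu> (cylinder A n \<omega>) /
                 exp (- real n * P + (\<Sum>k<n. f ((shift ^^ k) \<omega>)))
         in inverse C \<le> r \<and> r \<le> C))"

(* If some cylinder around a point has measure 0, then -(1/n) log mu(C_n) is eventually plus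
   infinity and the point lies in no level set. Since ln 0 = 0 in HOL, such points have to be
   excluded explicitly. *)
definition level_set :: "nat mat \<Rightarrow> (nat \<Rightarrow> nat) measure \<Rightarrow> real \<Rightarrow> (nat \<Rightarrow> nat) set" where
  "level_set A \<mu> \<alpha> =
     {\<omega> \<in> subshift A. (\<forall>n. measure \<mu> (cylinder A n \<omega>) > 0) \<and>
        (\<lambda>n. - (1 / real n) * ln (measure \<mu> (cylinder A n \<omega>))) \<longlonglongrightarrow> \<alpha>}"

(* A pair (m, w) stands for the cylinder C_m(w). *)
definition cylinder_covers ::
    "nat mat \<Rightarrow> nat \<Rightarrow> (nat \<Rightarrow> nat) set \<Rightarrow> (nat \<times> (nat \<Rightarrow> nat)) set set" where
  "cylinder_covers A n Z =
     {F. countable F \<and> F \<subseteq> {n..} \<times> subshift A \<and> Z \<subseteq> (\<Union>(m, \<omega>)\<in>F. cylinder A m \<omega>)}"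

(* The infimum is over a nonempty set of reals: as the alphabet is finite, every s > log N
   belongs to it. *)
definition bowen_entropy :: "nat mat \<Rightarrow> (nat \<Rightarrow> nat) set \<Rightarrow> real" where
  "bowen_entropy A Z =
     Inf {s. 0 \<le> s \<and>
       (\<lambda>n. INF F\<in>cylinder_covers A n Z. \<Sum>\<^sub>\<infinity>(m, \<omega>)\<in>F. ennreal (exp (- s * real m)))
         \<longlonglongrightarrow> 0}"

definition entropy_spectrum :: "nat mat \<Rightarrow> (nat \<Rightarrow> nat) measure \<Rightarrow> real \<Rightarrow> real" where
  "entropy_spectrum A \<mu> \<alpha> = bowen_entropy A (level_set A \<mu> \<alpha>)"

definition isomorphic_systems ::
    "nat mat \<Rightarrow> (nat \<Rightarrow> nat) measure \<Rightarrow> (nat \<Rightarrow> nat) measure \<Rightarrow> bool" where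
  "isomorphic_systems A \<mu> \<nu> \<longleftrightarrow>
     (\<exists>X\<in>sets (subshift_borel A). \<exists>Y\<in>sets (subshift_borel A). \<exists>\<Phi>.
        bij_betw \<Phi> X Y \<and>
        shift ` X \<subseteq> X \<and> shift ` Y \<subseteq> Y \<and> measure \<mu> X = 1 \<and> measure \<nu> Y = 1 \<and>
        \<Phi> \<in> measurable (restrict_space (subshift_borel A) X) (restrict_space (subshift_borel A) Y) \<and>
        inv_into X \<Phi> \<in>
          measurable (restrict_space (subshift_borel A) Y) (restrict_space (subshift_borel A) X) \<and>
        (\<forall>\<omega>\<in>X. \<Phi> (shift \<omega>) = shift (\<Phi> \<omega>)) \<and>
        (\<forall>B\<in>sets (subshift_borel A). B \<subseteq> X \<longrightarrow> measure \<mu> B = measure \<nu> (\<Phi> ` B)))"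

end

theory Submission
  imports Defs
begin

text \<open>
  By the Gibbs property the information \<open>a n \<omega> = - ln (measure \<mu> (cylinder A n \<omega>))\<close> is additive
  along orbits up to a bounded error. This has two consequences.

  Firstly, the entropy of a level set is a growth rate: it is determined by the exponential rate,
  for \<open>n \<longlonglongrightarrow> \<infinity>\<close> and then \<open>\<epsilon> \<longlonglongrightarrow> 0\<close>, of the number of words of length \<open>n\<close> whose information is
  within \<open>\<epsilon> * n\<close> of \<open>\<alpha> * n\<close>. The upper bound comes from covering by the cylinders of these words.
  For the lower bound one closes the words up to loops at a fixed symbol. Loops can be concatenated
  freely, and if their lengths grow slowly enough then all concatenations lie in the level set; a
  product measure distributes mass evenly over them.

  Secondly, the \<open>n\<close>-th iterate of the shift has an almost constant Jacobian on every cylinder of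
  length \<open>n\<close>. An isomorphism of one-sided systems preserves Jacobians, hence matches the words of
  both systems in such a way that their informations differ by a bounded amount, and the growth
  rates coincide.
\<close>

section \<open>Cylinders and Borel sets\<close>

text \<open>The isomorphism is only measurable. It need not carry cylinders to cylinders, and it
  says nothing directly about null sets, while level sets are typically null. What survives is a
  statement at a finite time n: however small the cylinder of a word of length n is, the n-th
  iterate spreads it over a set of measure at least \<open>exp (- K)\<close>, so unlikely words are
  as visible to the measure as likely ones. One-sidedness enters in the double count: a point is
  determined by its first n symbols together with its n-th shift, so that over a fixed word of one
  system the images belonging to different words of the other are disjoint. All errors are bounded
  independently of n and vanish in exponential rates.

  The obstacle in the lower entropy bound is that the growth rate is an upper limit. Lengths with
  many words may be very sparse, so one length has to be repeated in many blocks before the next,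
  possibly much longer one, can be afforded.\<close>

definition pref :: "nat \<Rightarrow> (nat \<Rightarrow> nat) \<Rightarrow> nat list" where
  "pref n \<omega> = map \<omega> [0..<n]"

lemma length_pref [simp]: "length (pref n \<omega>) = n"
  by (simp add: pref_def)

lemma nth_pref [simp]: "t < n \<Longrightarrow> pref n \<omega> ! t = \<omega> t"
  by (simp add: pref_def)

lemma pref_eq_iff: "pref n \<omega> = pref n \<omega>' \<longleftrightarrow> (\<forall>t<n. \<omega> t = \<omega>' t)"
  by (auto simp: pref_def)

lemma take_pref: "m \<le> n \<Longrightarrow> take m (pref n \<omega>) = pref m \<omega>"
  by (simp add: pref_def take_map)

lemma words_subset:
  "pref n ` subshift A \<subseteq> {xs. set xs \<subseteq> {1..dim_row A} \<and> length xs = n}"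
  by (auto simp: subshift_def pref_def)

lemma finite_words: "finite (pref n ` subshift A)"
  by (rule finite_subset[OF words_subset finite_lists_length_eq]) simp

lemma card_words_le: "card (pref n ` subshift A) \<le> dim_row A ^ n"
  using card_mono[OF finite_lists_length_eq words_subset[of n A]] card_lists_length_eq[of "{1..dim_row A}" n]
  by simp

lemma funpow_shift: "(shift ^^ n) \<omega> = (\<lambda>t. \<omega> (n + t))"
  by (induction n arbitrary: \<omega>) (auto simp: shift_def funpow_swap1)

lemma funpow_shift_in_subshift: "\<omega> \<in> subshift A \<Longrightarrow> (shift ^^ n) \<omega> \<in> subshift A"
  by (simp add: funpow_shift subshift_def)

lemma self_in_cylinder: "\<omega> \<in> subshift A \<Longrightarrow> \<omega> \<in> cylinder A n \<omega>"
  by (simp add: cylinder_def)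

lemma cylinder_subset: "cylinder A n \<omega> \<subseteq> subshift A"
  by (auto simp: cylinder_def)

lemma cylinder_eq: "\<omega>' \<in> cylinder A n \<omega> \<Longrightarrow> cylinder A n \<omega>' = cylinder A n \<omega>"
  by (auto simp: cylinder_def)

lemma cylinder_0: "cylinder A 0 \<omega> = subshift A"
  by (auto simp: cylinder_def)

lemma cylinder_cong: "(\<And>t. t < n \<Longrightarrow> \<omega> t = \<omega>' t) \<Longrightarrow> cylinder A n \<omega> = cylinder A n \<omega>'"
  by (auto simp: cylinder_def)


lemma cylinder_pref: "cylinder A n \<omega> = {\<omega>' \<in> subshift A. pref n \<omega>' = pref n \<omega>}"
  by (auto simp: cylinder_def pref_eq_iff)

lemma seq_dist_less_imp_eq:
  assumes "\<omega> \<in> subshift A" "\<omega>' \<in> subshift A" and d: "seq_dist \<omega> \<omega>' < 1 / 2 ^ n" and "t < n"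
  shows "\<omega> t = \<omega>' t"
proof -
  have "\<bar>real (\<omega> t) - real (\<omega>' t)\<bar> / 2 ^ t \<le> seq_dist \<omega> \<omega>'"
    unfolding seq_dist_def
    using finite_sum_le_infsum[OF seq_dist_summable[OF assms(1,2)], of "{t}"] by simp
  also have "\<dots> < 1 / 2 ^ n" by (rule d)
  also have "\<dots> \<le> 1 / 2 ^ t" using \<open>t < n\<close> by (simp add: frac_le)
  finally have "\<bar>real (\<omega> t) - real (\<omega>' t)\<bar> < 1"
    using divide_less_cancel[of _ "2 ^ t" 1] by auto
  then show ?thesis by linarith
qed

lemma seq_dist_le_if_eq:
  assumes "\<omega> \<in> subshift A" "\<omega>' \<in> subshift A" and eq: "\<And>t. t < n \<Longrightarrow> \<omega> t = \<omega>' t"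
  shows "seq_dist \<omega> \<omega>' \<le> 2 * real (dim_row A) / 2 ^ n"
proof -
  let ?f = "\<lambda>t. \<bar>real (\<omega> t) - real (\<omega>' t)\<bar> / 2 ^ t"
  have nonneg: "0 \<le> ?f t" for t by simp
  have bd: "\<bar>real (\<omega> t) - real (\<omega>' t)\<bar> \<le> real (dim_row A)" for t
  proof -
    have "\<omega> t \<le> dim_row A" "\<omega>' t \<le> dim_row A"
      using assms by (auto simp: subshift_def)
    then show ?thesis by linarith
  qed
  have "(?f has_sum seq_dist \<omega> \<omega>') UNIV"
    unfolding seq_dist_def by (rule has_sum_infsum[OF seq_dist_summable[OF assms(1,2)]])
  then have s: "?f sums seq_dist \<omega> \<omega>'" by (rule has_sum_imp_sums)
  have g: "(\<lambda>t. real (dim_row A) / 2 ^ n * (1 / 2) ^ t) sums (real (dim_row A) / 2 ^ n * 2)"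
    by (intro sums_mult) (use geometric_sums[of "1/2::real"] in simp)
  have "seq_dist \<omega> \<omega>' = (\<Sum>t. ?f (t + n)) + (\<Sum>t<n. ?f t)"
    using s suminf_split_initial_segment[of ?f n] by (simp add: sums_iff)
  also have "(\<Sum>t<n. ?f t) = 0" using eq by simp
  also have "(\<Sum>t. ?f (t + n)) \<le> (\<Sum>t. real (dim_row A) / 2 ^ n * (1 / 2) ^ t)"
  proof (rule suminf_le)
    show "?f (t + n) \<le> real (dim_row A) / 2 ^ n * (1 / 2) ^ t" for t
      using divide_right_mono[OF bd[of "t + n"], of "2 ^ (t + n)"]
      by (simp add: power_add power_one_over field_simps)
    show "summable (\<lambda>t. ?f (t + n))"
      using s by (intro summable_ignore_initial_segment) (auto simp: sums_iff)
    show "summable (\<lambda>t. real (dim_row A) / 2 ^ n * (1 / 2) ^ t)" using g by (simp add: sums_iff)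
  qed
  also have "\<dots> = 2 * real (dim_row A) / 2 ^ n" using g by (simp add: sums_iff)
  finally show ?thesis by simp
qed

text \<open>Balls of radius 1 / 2^n lie in cylinders of length n, and points of such a cylinder have
  distance at most 2 N / 2^n. From here on cylinders replace the metric.\<close>

lemma openin_subshift_iff:
  "openin (subshift_topology A) U \<longleftrightarrow>
     U \<subseteq> subshift A \<and> (\<forall>\<omega>\<in>U. \<exists>n. cylinder A n \<omega> \<subseteq> U)"
proof -
  interpret Metric_space "subshift A" seq_dist by (rule Metric_space_subshift)
  have 1: "\<exists>n. cylinder A n \<omega> \<subseteq> mball \<omega> r" if "\<omega> \<in> subshift A" "r > 0" for \<omega> r
  proof -
    have "(\<lambda>n. 2 * real (dim_row A) / 2 ^ n) \<longlonglongrightarrow> 0"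
      using tendsto_mult_right_zero[OF LIMSEQ_inverse_realpow_zero[of 2]]
      by (simp add: field_simps)
    then have "\<forall>\<^sub>F n in sequentially. 2 * real (dim_row A) / 2 ^ n < r"
      using that(2) by (rule order_tendstoD)
    then obtain n where n: "2 * real (dim_row A) / 2 ^ n < r" by (auto simp: eventually_sequentially)
    have "cylinder A n \<omega> \<subseteq> mball \<omega> r"
    proof
      fix \<omega>' assume w: "\<omega>' \<in> cylinder A n \<omega>"
      then have "seq_dist \<omega> \<omega>' \<le> 2 * real (dim_row A) / 2 ^ n"
        using that(1) by (intro seq_dist_le_if_eq) (auto simp: cylinder_def)
      with n w that(1) show "\<omega>' \<in> mball \<omega> r" by (auto simp: cylinder_def in_mball)
    qed
    then show ?thesis ..
  qed
  have 2: "mball \<omega> (1 / 2 ^ n) \<subseteq> cylinder A n \<omega>" for \<omega> n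
  proof
    fix \<omega>' assume "\<omega>' \<in> mball \<omega> (1 / 2 ^ n)"
    then have "\<omega> \<in> subshift A" "\<omega>' \<in> subshift A" "seq_dist \<omega> \<omega>' < 1 / 2 ^ n"
      unfolding in_mball by blast+
    from this(2) seq_dist_less_imp_eq[OF this, symmetric] show "\<omega>' \<in> cylinder A n \<omega>"
      unfolding cylinder_def by blast
  qed
  show ?thesis
    unfolding subshift_topology_def openin_mtopology
  proof (intro conj_cong refl iffI ballI)
    fix \<omega> assume "U \<subseteq> subshift A" "\<forall>x. x \<in> U \<longrightarrow> (\<exists>r>0. mball x r \<subseteq> U)" "\<omega> \<in> U"
    then obtain r where "r > 0" "mball \<omega> r \<subseteq> U" "\<omega> \<in> subshift A" by blast
    with 1[of \<omega> r] show "\<exists>n. cylinder A n \<omega> \<subseteq> U" by (meson order_trans)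
  next
    assume U: "\<forall>\<omega>\<in>U. \<exists>n. cylinder A n \<omega> \<subseteq> U"
    show "\<forall>x. x \<in> U \<longrightarrow> (\<exists>r>0. mball x r \<subseteq> U)"
    proof (intro allI impI)
      fix \<omega> assume "\<omega> \<in> U"
      with U obtain n where "cylinder A n \<omega> \<subseteq> U" by blast
      with 2[of \<omega> n] have "mball \<omega> (1 / 2 ^ n) \<subseteq> U" by (rule order_trans)
      then show "\<exists>r>0. mball \<omega> r \<subseteq> U" by (intro exI[of _ "1 / 2 ^ n"]) simp
    qed
  qed
qed

lemma openin_cylinder: "openin (subshift_topology A) (cylinder A n \<omega>)"
  unfolding openin_subshift_iff using cylinder_eq[of _ A n \<omega>] cylinder_subset by blast

lemma openin_in_sets: "openin (subshift_topology A) U \<Longrightarrow> U \<in> sets (subshift_borel A)"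
  by (auto simp: sets_subshift_borel)

lemma cylinder_in_sets [measurable]: "cylinder A n \<omega> \<in> sets (subshift_borel A)"
  by (intro openin_in_sets openin_cylinder)

lemma subshift_in_sets [measurable]: "subshift A \<in> sets (subshift_borel A)"
  using sets.top[of "subshift_borel A"] by (simp add: space_subshift_borel)

lemma subshift_cylinder_Collect:
  "{\<omega> \<in> subshift A. Q (pref n \<omega>)} \<in> sets (subshift_borel A)"
  by (intro openin_in_sets)
    (auto simp: openin_subshift_iff cylinder_pref intro!: exI[of _ n])

lemma countable_cylinders: "countable {cylinder A n \<omega> | n \<omega>. \<omega> \<in> subshift A}"
proof -
  have "{cylinder A n \<omega> | n \<omega>. \<omega> \<in> subshift A}
      = (\<Union>n. (\<lambda>xs. {\<omega>' \<in> subshift A. pref n \<omega>' = xs}) ` pref n ` subshift A)"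
    unfolding cylinder_pref by blast
  then show ?thesis by (auto intro!: countable_finite finite_imageI finite_words)
qed

text \<open>There are only countably many cylinders, so an open set is a countable union of those
  that it contains.\<close>

lemma sigma_cylinders_subset:
  assumes "openin (subshift_topology A) U"
  shows "U \<in> sigma_sets (subshift A) {cylinder A n \<omega> | n \<omega>. \<omega> \<in> subshift A}"
    (is "_ \<in> sigma_sets _ ?\<C>")
proof -
  have "U = \<Union> {C \<in> ?\<C>. C \<subseteq> U}"
    using assms self_in_cylinder[of _ A] unfolding openin_subshift_iff by blast
  moreover have "\<Union> {C \<in> ?\<C>. C \<subseteq> U} \<in> sigma_sets (subshift A) ?\<C>"
    by (rule sigma_sets_UNION) (auto intro: countable_subset[OF _ countable_cylinders])
  ultimately show ?thesis by simp
qed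

lemma sets_subshift_borel_cylinders:
  "sets (subshift_borel A) = sigma_sets (subshift A) {cylinder A n \<omega> | n \<omega>. \<omega> \<in> subshift A}"
  unfolding sets_subshift_borel
proof (rule sigma_sets_eqI)
  show "U \<in> sigma_sets (subshift A) {cylinder A n \<omega> | n \<omega>. \<omega> \<in> subshift A}"
    if "U \<in> {U. openin (subshift_topology A) U}" for U
    using that sigma_cylinders_subset by blast
qed (auto intro: openin_cylinder)

section \<open>Inverse branches of the iterated shift\<close>

text \<open>The inverse branch of \<open>shift ^^ n\<close> on the cylinder of length
  \<open>n\<close> around \<open>\<omega>\<close>. It is a total function, whose value lies outside
  \<open>subshift A\<close> if, for instance, the transition from the last prepended symbol to
  \<open>u 0\<close> is forbidden.\<close>

definition prepend :: "nat \<Rightarrow> (nat \<Rightarrow> nat) \<Rightarrow> (nat \<Rightarrow> nat) \<Rightarrow> (nat \<Rightarrow> nat)" where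
  "prepend n \<omega> u = (\<lambda>t. if t < n then \<omega> t else u (t - n))"

lemma prepend_shift: "\<omega>' \<in> cylinder A n \<omega> \<Longrightarrow> prepend n \<omega> ((shift ^^ n) \<omega>') = \<omega>'"
  by (auto simp: prepend_def funpow_shift cylinder_def)

lemma shift_prepend: "(shift ^^ n) (prepend n \<omega> u) = u"
  by (auto simp: prepend_def funpow_shift)

lemma prepend_in_subshift:
  assumes "prepend n \<omega> u \<in> subshift A" "u' \<in> subshift A" "u' 0 = u 0"
  shows "prepend n \<omega> u' \<in> subshift A"
proof -
  have "prepend n \<omega> u' t \<in> {1..dim_row A} \<and>
      A $$ (prepend n \<omega> u' t - 1, prepend n \<omega> u' (Suc t) - 1) = 1" for t
  proof (cases "t < n")
    case True
    then have "prepend n \<omega> u' t = prepend n \<omega> u t" "prepend n \<omega> u' (Suc t) = prepend n \<omega> u (Suc t)"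
      using assms(3) by (auto simp: prepend_def not_less le_Suc_eq)
    with assms(1) show ?thesis by (simp add: subshift_def)
  next
    case False
    with assms(2) show ?thesis by (auto simp: subshift_def prepend_def Suc_diff_le)
  qed
  then show ?thesis by (auto simp: subshift_def)
qed

text \<open>Measurability of the shift controls preimages only. This is for forward images: on a
  cylinder they are preimages under the inverse branch. As the branch need not map into the shift
  space, the argument is an induction over the sigma-algebra.\<close>

lemma prepend_vimage_in_sets:
  assumes "B \<in> sets (subshift_borel A)"
  shows "{u \<in> subshift A. prepend n \<omega> u \<in> B} \<in> sets (subshift_borel A)"
  using assms unfolding sets_subshift_borel_cylinders[of A]
proof (induction rule: sigma_sets.induct)
  have op: "{u \<in> subshift A. prepend n \<omega> u \<in> B} \<in> sets (subshift_borel A)"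
    if B: "openin (subshift_topology A) B" for B
  proof (rule openin_in_sets, unfold openin_subshift_iff, intro conjI ballI)
    fix u assume "u \<in> {u \<in> subshift A. prepend n \<omega> u \<in> B}"
    then have u: "u \<in> subshift A" "prepend n \<omega> u \<in> B" by auto
    then obtain m where m: "cylinder A m (prepend n \<omega> u) \<subseteq> B"
      using B by (auto simp: openin_subshift_iff)
    have "prepend n \<omega> u \<in> subshift A" using B u by (auto simp: openin_subshift_iff)
    \<comment> \<open>Agreement on \<open>Suc m\<close> symbols includes position 0 even if
      \<open>m = 0\<close>, which keeps the junction admissible.\<close>
    have "prepend n \<omega> u' \<in> cylinder A m (prepend n \<omega> u)" if "u' \<in> cylinder A (Suc m) u" for u'
    proof -
      have *: "\<And>t. t \<le> m \<Longrightarrow> u' t = u t" "u' \<in> subshift A" using that by (auto simp: cylinder_def)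
      have "prepend n \<omega> u' \<in> subshift A"
        using prepend_in_subshift[OF \<open>prepend n \<omega> u \<in> subshift A\<close> *(2)] *(1)[of 0] by simp
      with *(1) show ?thesis by (auto simp: cylinder_def prepend_def)
    qed
    with m show "\<exists>m. cylinder A m u \<subseteq> {u \<in> subshift A. prepend n \<omega> u \<in> B}"
      by (intro exI[of _ "Suc m"]) (auto simp: cylinder_def)
  qed auto
  {
    case (Basic B)
    then show ?case using op openin_cylinder sets_subshift_borel_cylinders by blast
  next
    case Empty
    show ?case by (simp add: sigma_sets.Empty)
  next
    case (Compl B)
    \<comment> \<open>The branch may leave the shift space, so the complement is formed inside the
      preimage of \<open>subshift A\<close>, which is open.\<close>
    have "{u \<in> subshift A. prepend n \<omega> u \<in> subshift A - B}
        = {u \<in> subshift A. prepend n \<omega> u \<in> subshift A} - {u \<in> subshift A. prepend n \<omega> u \<in> B}"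
      by auto
    also have "\<dots> \<in> sets (subshift_borel A)"
      using Compl op[of "subshift A"]
      by (intro sets.Diff) (auto simp: sets_subshift_borel_cylinders openin_subshift_iff cylinder_def)
    finally show ?case by (simp add: sets_subshift_borel_cylinders)
  next
    case (Union B)
    have "{u \<in> subshift A. prepend n \<omega> u \<in> (\<Union>i. B i)} = (\<Union>i. {u \<in> subshift A. prepend n \<omega> u \<in> B i})"
      by auto
    then show ?case
      unfolding sets_subshift_borel_cylinders using Union(2) by (auto intro!: sigma_sets.Union)
  }
qed

lemma shift_image_eq_prepend:
  assumes "B \<subseteq> cylinder A n \<omega>"
  shows "(shift ^^ n) ` B = {u \<in> subshift A. prepend n \<omega> u \<in> B}"
proof (intro equalityI subsetI)
  fix u assume "u \<in> (shift ^^ n) ` B"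
  with assms show "u \<in> {u \<in> subshift A. prepend n \<omega> u \<in> B}"
    using prepend_shift[of _ A n \<omega>] by (auto intro!: funpow_shift_in_subshift simp: cylinder_def)
next
  fix u assume "u \<in> {u \<in> subshift A. prepend n \<omega> u \<in> B}"
  then show "u \<in> (shift ^^ n) ` B" by (metis (lifting) image_eqI mem_Collect_eq shift_prepend)
qed

lemma shift_image_in_sets:
  assumes "B \<in> sets (subshift_borel A)" "B \<subseteq> cylinder A n \<omega>"
  shows "(shift ^^ n) ` B \<in> sets (subshift_borel A)"
  using prepend_vimage_in_sets[OF assms(1)] shift_image_eq_prepend[OF assms(2)] by simp

lemma measurable_subshiftI:
  assumes "f \<in> subshift A \<rightarrow> subshift B"
    and "\<And>\<omega> n. \<omega> \<in> subshift B \<Longrightarrow> f -` cylinder B n \<omega> \<inter> subshift A \<in> sets (subshift_borel A)"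
  shows "f \<in> measurable (subshift_borel A) (subshift_borel B)"
  using assms
  by (intro measurable_sigma_sets[OF sets_subshift_borel_cylinders])
    (auto simp: space_subshift_borel cylinder_def)

lemma measurable_funpow_shift [measurable]:
  "shift ^^ n \<in> measurable (subshift_borel A) (subshift_borel A)"
proof (rule measurable_subshiftI)
  show "shift ^^ n \<in> subshift A \<rightarrow> subshift A" by (auto intro: funpow_shift_in_subshift)
  fix \<omega> m
  show "(shift ^^ n) -` cylinder A m \<omega> \<inter> subshift A \<in> sets (subshift_borel A)"
  proof (intro openin_in_sets, unfold openin_subshift_iff, intro conjI ballI)
    fix \<omega>' assume w: "\<omega>' \<in> (shift ^^ n) -` cylinder A m \<omega> \<inter> subshift A"
    have "cylinder A (n + m) \<omega>' \<subseteq> (shift ^^ n) -` cylinder A m \<omega> \<inter> subshift A"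
      using w by (auto simp: cylinder_def funpow_shift subshift_def)
    then show "\<exists>n'. cylinder A n' \<omega>' \<subseteq> (shift ^^ n) -` cylinder A m \<omega> \<inter> subshift A" by blast
  qed auto
qed

section \<open>Quasi-Bernoulli measures\<close>

text \<open>\<open>Suc n\<close> makes such a set a union of cylinders of positive length. These fix
  the first symbol, which decides in \<open>quasi_jacobian\<close> whether a tail may follow a given
  word.\<close>

definition prefix_sets :: "nat mat \<Rightarrow> (nat \<Rightarrow> nat) set set" where
  "prefix_sets A = {{\<omega> \<in> subshift A. Q (pref (Suc n) \<omega>)} | n Q. True}"

lemma prefix_setsI: "E = {\<omega> \<in> subshift A. Q (pref (Suc n) \<omega>)} \<Longrightarrow> E \<in> prefix_sets A"
  unfolding prefix_sets_def by blast

lemma prefix_setsE: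
  assumes "E \<in> prefix_sets A"
  obtains n Q where "E = {\<omega> \<in> subshift A. Q (pref (Suc n) \<omega>)}"
  using assms unfolding prefix_sets_def by blast

lemma prefix_sets_in_sets: "E \<in> prefix_sets A \<Longrightarrow> E \<in> sets (subshift_borel A)"
  by (erule prefix_setsE) (simp only: subshift_cylinder_Collect)

lemma prefix_sets_Compl:
  assumes "E \<in> prefix_sets A"
  shows "subshift A - E \<in> prefix_sets A"
proof -
  from assms obtain n Q where "E = {\<omega> \<in> subshift A. Q (pref (Suc n) \<omega>)}" by (rule prefix_setsE)
  then have "subshift A - E = {\<omega> \<in> subshift A. \<not> Q (pref (Suc n) \<omega>)}" by blast
  then show ?thesis by (rule prefix_setsI)
qed

lemma prefix_sets_empty: "{} \<in> prefix_sets A"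
  by (rule prefix_setsI[of _ _ "\<lambda>_. False" 0]) simp

lemma prefix_sets_Un:
  assumes "E \<in> prefix_sets A" "F \<in> prefix_sets A"
  shows "E \<union> F \<in> prefix_sets A"
proof -
  from assms(1) obtain n Q where E: "E = {\<omega> \<in> subshift A. Q (pref (Suc n) \<omega>)}" by (rule prefix_setsE)
  from assms(2) obtain m R where F: "F = {\<omega> \<in> subshift A. R (pref (Suc m) \<omega>)}" by (rule prefix_setsE)
  have take: "take (Suc n) (pref (Suc (max n m)) \<omega>) = pref (Suc n) \<omega>"
    "take (Suc m) (pref (Suc (max n m)) \<omega>) = pref (Suc m) \<omega>" for \<omega>
    by (rule take_pref, simp)+
  have "E \<union> F = {\<omega> \<in> subshift A. Q (take (Suc n) (pref (Suc (max n m)) \<omega>)) \<or>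
      R (take (Suc m) (pref (Suc (max n m)) \<omega>))}"
    unfolding E F take by blast
  then show ?thesis
    by (rule prefix_setsI[where Q = "\<lambda>xs. Q (take (Suc n) xs) \<or> R (take (Suc m) xs)"])
qed

lemma prefix_sets_UN:
  assumes "\<And>i::nat. E i \<in> prefix_sets A"
  shows "(\<Union>i<n. E i) \<in> prefix_sets A"
  by (induction n) (simp_all add: lessThan_Suc prefix_sets_empty prefix_sets_Un assms)

lemma measure_UN_diff_tendsto:
  assumes "finite_measure M" "\<And>i::nat. B i \<in> sets M"
  shows "(\<lambda>n. measure M ((\<Union>i. B i) - (\<Union>i<n. B i))) \<longlonglongrightarrow> 0"
proof -
  interpret finite_measure M by fact
  have "(\<lambda>n. measure M ((\<Union>i. B i) - (\<Union>i<n. B i))) \<longlonglongrightarrow> measure M (\<Inter>n. (\<Union>i. B i) - (\<Union>i<n. B i))"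
    using assms(2) by (intro finite_Lim_measure_decseq) (auto simp: decseq_def)
  also have "(\<Inter>n. (\<Union>i. B i) - (\<Union>i<n. B i)) = {}" by auto
  finally show ?thesis by simp
qed

text \<open>One and the same \<open>E\<close> serves both measures, which is what allows an
  inequality between them to pass from such sets to \<open>B\<close>.\<close>

lemma subshift_borel_approx:
  assumes M: "finite_measure M" "sets M = sets (subshift_borel A)"
    and N: "finite_measure N" "sets N = sets (subshift_borel A)"
    and "B \<in> sets (subshift_borel A)" "0 < \<epsilon>"
  shows "\<exists>E\<in>prefix_sets A. measure M (sym_diff B E) < \<epsilon> \<and> measure N (sym_diff B E) < \<epsilon>"
proof -
  have "B \<in> sigma_sets (subshift A) {cylinder A n \<omega> | n \<omega>. \<omega> \<in> subshift A}"
    using assms(5) by (simp add: sets_subshift_borel_cylinders)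
  then show ?thesis using \<open>0 < \<epsilon>\<close>
  proof (induction arbitrary: \<epsilon> rule: sigma_sets.induct)
    case (Basic B)
    then obtain n \<omega> where B: "B = cylinder A n \<omega>" by auto
    have "B = {\<omega>' \<in> subshift A. take n (pref (Suc n) \<omega>') = pref n \<omega>}"
      by (simp add: B cylinder_pref take_pref)
    then have "B \<in> prefix_sets A" by (rule prefix_setsI)
    with \<open>0 < \<epsilon>\<close> show ?case by (intro bexI[of _ B]) simp_all
  next
    case Empty
    then show ?case by (intro bexI[of _ "{}"] prefix_sets_empty) auto
  next
    case (Compl B)
    then obtain E where E: "E \<in> prefix_sets A"
      "measure M (sym_diff B E) < \<epsilon>" "measure N (sym_diff B E) < \<epsilon>" by blast
    have "B \<subseteq> subshift A"
      using Compl sets.sets_into_space[of B "subshift_borel A"]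
      by (simp add: space_subshift_borel sets_subshift_borel_cylinders)
    moreover have "E \<subseteq> subshift A" using E(1) by (rule prefix_setsE) blast
    ultimately have "sym_diff (subshift A - B) (subshift A - E) = sym_diff B E" by blast
    with E prefix_sets_Compl[OF E(1)] show ?case by (intro bexI[of _ "subshift A - E"]) auto
  next
    case (Union B)
    have B: "B i \<in> sets (subshift_borel A)" for i
      using Union by (simp add: sets_subshift_borel_cylinders)
    have "\<forall>\<^sub>F n in sequentially. measure M ((\<Union>i. B i) - (\<Union>i<n. B i)) < \<epsilon> / 2"
      by (rule order_tendstoD(2)[OF measure_UN_diff_tendsto]) (use M B \<open>0 < \<epsilon>\<close> in simp_all)
    moreover have "\<forall>\<^sub>F n in sequentially. measure N ((\<Union>i. B i) - (\<Union>i<n. B i)) < \<epsilon> / 2"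
      by (rule order_tendstoD(2)[OF measure_UN_diff_tendsto]) (use N B \<open>0 < \<epsilon>\<close> in simp_all)
    ultimately have "\<forall>\<^sub>F n in sequentially. measure M ((\<Union>i. B i) - (\<Union>i<n. B i)) < \<epsilon> / 2 \<and>
        measure N ((\<Union>i. B i) - (\<Union>i<n. B i)) < \<epsilon> / 2"
      by (rule eventually_conj)
    then obtain n where n: "measure M ((\<Union>i. B i) - (\<Union>i<n. B i)) < \<epsilon> / 2"
      "measure N ((\<Union>i. B i) - (\<Union>i<n. B i)) < \<epsilon> / 2"
      using eventually_happens'[OF sequentially_bot] by blast
    \<comment> \<open>The number \<open>n\<close> of sets is fixed before they are approximated, so
      that all of them together use up at most \<epsilon> / 2. The summand 1 keeps the share
      meaningful for \<open>n = 0\<close>.\<close>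
    have "\<exists>E. \<forall>i. E i \<in> prefix_sets A \<and> measure M (sym_diff (B i) (E i)) < \<epsilon> / (2 * (real n + 1)) \<and>
        measure N (sym_diff (B i) (E i)) < \<epsilon> / (2 * (real n + 1))"
      using Union by (intro choice) (force simp: Bex_def)
    then obtain E where E: "\<And>i. E i \<in> prefix_sets A"
      and EM: "\<And>i. measure M (sym_diff (B i) (E i)) < \<epsilon> / (2 * (real n + 1))"
      and EN: "\<And>i. measure N (sym_diff (B i) (E i)) < \<epsilon> / (2 * (real n + 1))" by blast
    have bound: "measure L (sym_diff (\<Union>i. B i) (\<Union>i<n. E i)) < \<epsilon>"
      if L: "finite_measure L" "sets L = sets (subshift_borel A)"
        and L1: "measure L ((\<Union>i. B i) - (\<Union>i<n. B i)) < \<epsilon> / 2"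
        and L2: "\<And>i. measure L (sym_diff (B i) (E i)) < \<epsilon> / (2 * (real n + 1))" for L
    proof -
      interpret L: finite_measure L by (rule L)
      have meas: "B i \<in> sets L" "E i \<in> sets L" for i
        using B E prefix_sets_in_sets L(2) by auto
      have "measure L (sym_diff (\<Union>i. B i) (\<Union>i<n. E i))
          \<le> measure L (((\<Union>i. B i) - (\<Union>i<n. B i)) \<union> (\<Union>i<n. sym_diff (B i) (E i)))"
        using meas by (intro L.finite_measure_mono) auto
      also have "\<dots> \<le> measure L ((\<Union>i. B i) - (\<Union>i<n. B i)) + measure L (\<Union>i<n. sym_diff (B i) (E i))"
        using meas by (intro measure_Un_le) auto
      also have "measure L (\<Union>i<n. sym_diff (B i) (E i)) \<le> (\<Sum>i<n. measure L (sym_diff (B i) (E i)))"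
        using meas by (intro L.finite_measure_subadditive_finite) auto
      also have "\<dots> \<le> (\<Sum>i<n. \<epsilon> / (2 * (real n + 1)))"
        by (intro sum_mono less_imp_le L2)
      also have "\<dots> \<le> \<epsilon> / 2" using \<open>0 < \<epsilon>\<close> by (simp add: field_simps)
      finally show ?thesis using L1 by simp
    qed
    show ?case
      using bound[OF M n(1) EM] bound[OF N n(2) EN] by (intro bexI[of _ "\<Union>i<n. E i"] prefix_sets_UN E) auto
  qed
qed

lemma measure_le_if_cylinder_le:
  assumes M: "finite_measure M" "sets M = sets (subshift_borel A)"
    and N: "finite_measure N" "sets N = sets (subshift_borel A)"
    and "0 \<le> c"
    and le: "\<And>n \<omega>. \<omega> \<in> subshift A \<Longrightarrow>
      measure M (cylinder A (Suc n) \<omega>) \<le> c * measure N (cylinder A (Suc n) \<omega>)"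
    and B: "B \<in> sets (subshift_borel A)"
  shows "measure M B \<le> c * measure N B"
proof -
  interpret M: finite_measure M by (rule M)
  interpret N: finite_measure N by (rule N)
  have level: "measure M E \<le> c * measure N E" if "E \<in> prefix_sets A" for E
  proof -
    from that obtain n Q where E: "E = {\<omega> \<in> subshift A. Q (pref (Suc n) \<omega>)}"
      by (rule prefix_setsE)
    define P where "P = {p \<in> pref (Suc n) ` subshift A. Q p}"
    define C where "C p = {\<omega> \<in> subshift A. pref (Suc n) \<omega> = p}" for p
    have EU: "E = (\<Union>p\<in>P. C p)" by (auto simp: E P_def C_def)
    have fin: "finite P" using finite_words[of "Suc n" A] by (simp add: P_def)
    have meas: "C p \<in> sets (subshift_borel A)" for p
      unfolding C_def by (rule subshift_cylinder_Collect)
    have disj: "disjoint_family_on C P" by (auto simp: disjoint_family_on_def C_def)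
    have "measure M E = (\<Sum>p\<in>P. measure M (C p))"
      unfolding EU using fin disj meas M(2) by (intro M.finite_measure_finite_Union) auto
    also have "\<dots> \<le> (\<Sum>p\<in>P. c * measure N (C p))"
    proof (rule sum_mono)
      fix p assume "p \<in> P"
      then obtain \<omega> where "\<omega> \<in> subshift A" "C p = cylinder A (Suc n) \<omega>"
        by (auto simp: P_def C_def cylinder_pref)
      with le show "measure M (C p) \<le> c * measure N (C p)" by simp
    qed
    also have "\<dots> = c * (\<Sum>p\<in>P. measure N (C p))" by (simp add: sum_distrib_left)
    also have "(\<Sum>p\<in>P. measure N (C p)) = measure N E"
      unfolding EU using fin disj meas N(2) by (intro N.finite_measure_finite_Union[symmetric]) auto
    finally show ?thesis .
  qed
  have "measure M B \<le> c * measure N B + (1 + c) * \<epsilon>" if "0 < \<epsilon>" for \<epsilon>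
  proof -
    obtain E where E: "E \<in> prefix_sets A" "measure M (sym_diff B E) < \<epsilon>" "measure N (sym_diff B E) < \<epsilon>"
      using subshift_borel_approx[OF M N B \<open>0 < \<epsilon>\<close>] by blast
    have meas: "E \<in> sets M" "B \<in> sets M" "E \<in> sets N" "B \<in> sets N"
      using prefix_sets_in_sets[OF E(1)] B M N by auto
    have "measure M B \<le> measure M (E \<union> sym_diff B E)"
      using meas by (intro M.finite_measure_mono) auto
    also have "\<dots> \<le> measure M E + measure M (sym_diff B E)"
      using meas by (intro measure_Un_le) auto
    also have "\<dots> \<le> c * measure N E + \<epsilon>" using level[OF E(1)] E(2) by simp
    also have "c * measure N E \<le> c * (measure N B + \<epsilon>)"
    proof (rule mult_left_mono[OF _ \<open>0 \<le> c\<close>])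
      have "measure N E \<le> measure N (B \<union> sym_diff B E)"
        using meas by (intro N.finite_measure_mono) auto
      also have "\<dots> \<le> measure N B + measure N (sym_diff B E)"
        using meas by (intro measure_Un_le) auto
      finally show "measure N E \<le> measure N B + \<epsilon>" using E(3) by simp
    qed
    finally show ?thesis by (simp add: algebra_simps)
  qed
  from this[of "_ / (1 + c)"] have "measure M B \<le> c * measure N B + \<epsilon>" if "0 < \<epsilon>" for \<epsilon>
    using that \<open>0 \<le> c\<close> by simp
  then show ?thesis by (rule field_le_epsilon)
qed

section \<open>Measures with almost additive information\<close>

definition cyl_info :: "nat mat \<Rightarrow> (nat \<Rightarrow> nat) measure \<Rightarrow> nat \<Rightarrow> (nat \<Rightarrow> nat) \<Rightarrow> real" where
  "cyl_info A \<mu> n \<omega> = - ln (measure \<mu> (cylinder A n \<omega>))"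

text \<open>In multiplicative form, the measure of a cylinder of length \<open>n + m\<close> is, up
  to the factor \<open>exp K\<close>, the product of the measures of the cylinder of its first
  \<open>n\<close> symbols and the cylinder of its last \<open>m\<close> symbols. Potential and
  pressure cancel in this comparison and do not appear.\<close>

locale quasi_bernoulli = prob_space \<mu> for \<mu> :: "(nat \<Rightarrow> nat) measure" +
  fixes A :: "nat mat" and K :: real
  assumes sets_eq: "sets \<mu> = sets (subshift_borel A)"
    and cylinder_pos: "\<omega> \<in> subshift A \<Longrightarrow> 0 < measure \<mu> (cylinder A n \<omega>)"
    and quasi_additive: "\<omega> \<in> subshift A \<Longrightarrow>
      \<bar>cyl_info A \<mu> (n + m) \<omega> - cyl_info A \<mu> n \<omega> - cyl_info A \<mu> m ((shift ^^ n) \<omega>)\<bar> \<le> K"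
begin

lemma space_eq: "space \<mu> = subshift A"
  using sets_eq_imp_space_eq[OF sets_eq] by (simp add: space_subshift_borel)

lemma measurable_shift: "shift ^^ n \<in> measurable \<mu> \<mu>"
  using measurable_funpow_shift[of n A] measurable_cong_sets[OF sets_eq sets_eq] by simp

lemma measure_cylinder: "\<omega> \<in> subshift A \<Longrightarrow> measure \<mu> (cylinder A n \<omega>) = exp (- cyl_info A \<mu> n \<omega>)"
  using cylinder_pos by (simp add: cyl_info_def)

text \<open>Up to the factor \<open>exp K\<close>, the map \<open>shift ^^ n\<close> has the constant Jacobian
  \<open>1 / measure \<mu> (cylinder A n \<omega>)\<close> on a cylinder of length \<open>n\<close>.\<close>

lemma quasi_jacobian:
  assumes \<omega>: "\<omega> \<in> subshift A"
    and B: "B \<in> sets (subshift_borel A)" "B \<subseteq> cylinder A n \<omega>"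
  shows "measure \<mu> B \<le> exp K * measure \<mu> (cylinder A n \<omega>) * measure \<mu> ((shift ^^ n) ` B)" (is ?le)
    and "measure \<mu> (cylinder A n \<omega>) * measure \<mu> ((shift ^^ n) ` B) \<le> exp K * measure \<mu> B" (is ?ge)
proof -
  define C where "C = cylinder A n \<omega>"
  define D where "D = {u \<in> subshift A. prepend n \<omega> u \<in> subshift A}"
  define c where "c = measure \<mu> C"
  have C: "C \<in> sets \<mu>" by (simp add: C_def sets_eq cylinder_in_sets)
  have D: "D \<in> sets \<mu>" unfolding D_def sets_eq by (rule prepend_vimage_in_sets) simp
  have c: "0 < c" using cylinder_pos[OF \<omega>] by (simp add: c_def C_def)
  \<comment> \<open>\<open>M\<close> is \<mu> restricted to the cylinder and pushed forward by the
    n-th iterate, \<open>N\<close> is \<mu> restricted to the tails that may follow the word. On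
    inadmissible tails \<open>M\<close> vanishes although \<mu> need not, so \<open>M\<close> is
    compared with \<open>c\<close> times \<open>N\<close> and not with \<mu>.\<close>
  define M where "M = distr (density \<mu> (indicator C)) \<mu> (shift ^^ n)"
  define N where "N = density \<mu> (indicator D)"
  have meas: "shift ^^ n \<in> measurable (density \<mu> (indicator C)) \<mu>"
    using measurable_shift by simp
  have M: "finite_measure M" "sets M = sets (subshift_borel A)"
    unfolding M_def using finite_measure_restricted[OF C] meas sets_eq
    by (auto intro: finite_measure.finite_measure_distr)
  have N: "finite_measure N" "sets N = sets (subshift_borel A)"
    unfolding N_def using finite_measure_restricted[OF D] sets_eq by auto
  have measure_M: "measure M G = measure \<mu> (C \<inter> ((shift ^^ n) -` G \<inter> subshift A))"
    if "G \<in> sets (subshift_borel A)" for G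
    unfolding M_def using that measurable_sets[OF measurable_shift, of G n] C
    by (subst measure_distr[OF meas]) (simp_all add: sets_eq space_eq measure_restricted)
  have measure_N: "measure N G = measure \<mu> (D \<inter> G)" if "G \<in> sets (subshift_borel A)" for G
    unfolding N_def using that D by (simp add: sets_eq measure_restricted)
  have cyl: "measure M (cylinder A (Suc m) u) \<le> exp K * c * measure N (cylinder A (Suc m) u) \<and>
      measure N (cylinder A (Suc m) u) \<le> exp K / c * measure M (cylinder A (Suc m) u)"
    if u: "u \<in> subshift A" for m u
  proof (cases "u \<in> D")
    case True
    let ?w = "prepend n \<omega> u"
    have w: "?w \<in> subshift A" using True by (simp add: D_def)
    have "C \<inter> ((shift ^^ n) -` cylinder A (Suc m) u \<inter> subshift A) = cylinder A (n + Suc m) ?w"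
    proof (intro equalityI subsetI)
      fix x assume x: "x \<in> C \<inter> ((shift ^^ n) -` cylinder A (Suc m) u \<inter> subshift A)"
      then have "x t = ?w t" if "t < n + Suc m" for t
        using that by (cases "t < n") (auto simp: C_def cylinder_def prepend_def funpow_shift
            dest!: spec[of _ "t - n"])
      with x show "x \<in> cylinder A (n + Suc m) ?w" by (auto simp: cylinder_def)
    next
      fix x assume "x \<in> cylinder A (n + Suc m) ?w"
      then show "x \<in> C \<inter> ((shift ^^ n) -` cylinder A (Suc m) u \<inter> subshift A)"
        using funpow_shift_in_subshift[of x A n]
        by (auto simp: C_def cylinder_def prepend_def funpow_shift)
    qed
    moreover have "D \<inter> cylinder A (Suc m) u = cylinder A (Suc m) u"
      using prepend_in_subshift[OF w] by (auto simp: D_def cylinder_def)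
    moreover have "C = cylinder A n ?w" unfolding C_def by (rule cylinder_cong) (simp add: prepend_def)
    ultimately have eqs: "measure M (cylinder A (Suc m) u) = exp (- cyl_info A \<mu> (n + Suc m) ?w)"
      "measure N (cylinder A (Suc m) u) = exp (- cyl_info A \<mu> (Suc m) u)"
      "c = exp (- cyl_info A \<mu> n ?w)"
      by (simp_all add: measure_M measure_N cylinder_in_sets c_def measure_cylinder w u)
    show ?thesis
      using quasi_additive[OF w, of n "Suc m"]
      by (simp add: eqs shift_prepend exp_add[symmetric] exp_diff[symmetric] abs_le_iff algebra_simps)
  next
    case False
    \<comment> \<open>A cylinder of positive length fixes the first symbol, so it lies entirely
      outside \<open>D\<close>, and both measures vanish on it.\<close>
    have "prepend n \<omega> u' \<notin> subshift A" if "u' \<in> cylinder A (Suc m) u" for u'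
      using False prepend_in_subshift[OF _ u, of n \<omega> u'] u that by (auto simp: D_def cylinder_def)
    then have "C \<inter> ((shift ^^ n) -` cylinder A (Suc m) u \<inter> subshift A) = {}"
      "D \<inter> cylinder A (Suc m) u = {}"
      using prepend_shift[of _ A n \<omega>] by (auto simp: C_def D_def) metis
    then show ?thesis by (simp add: measure_M measure_N cylinder_in_sets)
  qed
  define G where "G = (shift ^^ n) ` B"
  have G: "G \<in> sets (subshift_borel A)" unfolding G_def by (rule shift_image_in_sets[OF B])
  \<comment> \<open>The n-th iterate is injective on a cylinder of length \<open>n\<close>, hence no
    other point of \<open>C\<close> is mapped into \<open>G\<close>.\<close>
  have "C \<inter> ((shift ^^ n) -` G \<inter> subshift A) = B"
  proof (intro equalityI subsetI)
    fix x assume "x \<in> C \<inter> ((shift ^^ n) -` G \<inter> subshift A)"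
    then obtain y where y: "y \<in> B" "x \<in> C" "(shift ^^ n) x = (shift ^^ n) y" by (auto simp: G_def)
    with B(2) have "y \<in> cylinder A n \<omega>" "x \<in> cylinder A n \<omega>" by (auto simp: C_def)
    with y prepend_shift show "x \<in> B" by metis
  qed (use B in \<open>auto simp: C_def G_def cylinder_def\<close>)
  moreover have "D \<inter> G = G"
    using shift_image_eq_prepend[OF B(2)] B(2) by (auto simp: D_def G_def cylinder_def)
  ultimately have eqs: "measure M G = measure \<mu> B" "measure N G = measure \<mu> G"
    by (simp_all add: measure_M measure_N G)
  have "measure M G \<le> exp K * c * measure N G"
    using measure_le_if_cylinder_le[OF M N, of "exp K * c" G] cyl c G by simp
  then show ?le unfolding eqs unfolding c_def C_def G_def .
  have "measure N G \<le> exp K / c * measure M G"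
    using measure_le_if_cylinder_le[OF N M, of "exp K / c" G] cyl c G by simp
  then have "c * measure \<mu> G \<le> exp K * measure \<mu> B" using c unfolding eqs by (simp add: field_simps)
  then show ?ge unfolding c_def C_def G_def .
qed

end

section \<open>Counting words under an isomorphism\<close>

text \<open>Words are collected instead of points in order to have a finite set to count; by
  \<open>cyl_info_cong\<close> the information depends on the word only. The tolerance
  \<open>e\<close> is absolute, so bounded errors simply add to it.\<close>

definition info_words ::
    "nat mat \<Rightarrow> (nat \<Rightarrow> nat) measure \<Rightarrow> nat \<Rightarrow> real \<Rightarrow> real \<Rightarrow> nat list set" where
  "info_words A \<mu> n x e = {pref n \<omega> | \<omega>. \<omega> \<in> subshift A \<and> \<bar>cyl_info A \<mu> n \<omega> - x\<bar> \<le> e}"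

lemma info_words_subset: "info_words A \<mu> n x e \<subseteq> pref n ` subshift A"
  by (auto simp: info_words_def)

lemma finite_info_words: "finite (info_words A \<mu> n x e)"
  by (rule finite_subset[OF info_words_subset finite_words])

lemma cyl_info_cong: "pref n \<omega> = pref n \<omega>' \<Longrightarrow> cyl_info A \<mu> n \<omega> = cyl_info A \<mu> n \<omega>'"
  by (simp add: cyl_info_def cylinder_pref)

text \<open>The isomorphism maps the pieces \<open>B p q\<close> of a partition to each other, and both measures
  have on \<open>B p q\<close> an almost constant Jacobian for the \<open>n\<close>-th iterate. As \<open>\<Phi>\<close> intertwines the
  shifts and preserves measure, the two constants agree up to a bounded factor whenever
  \<open>B p q\<close> is not null. Measuring the images \<open>S p q\<close> of these pieces under the \<open>n\<close>-th iterate then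
  amounts to counting words.\<close>

lemma card_info_words_le_if_isomorphic:
  assumes "quasi_bernoulli \<mu> A K" "quasi_bernoulli \<nu> A L" "isomorphic_systems A \<mu> \<nu>"
  shows "real (card (info_words A \<mu> n x e)) \<le> exp K * real (card (info_words A \<nu> n x (e + K + L)))"
proof -
  interpret M: quasi_bernoulli \<mu> A K by fact
  interpret N: quasi_bernoulli \<nu> A L by fact
  let ?\<B> = "sets (subshift_borel A)"
  obtain X Y \<Phi> where X: "X \<in> ?\<B>" and Y: "Y \<in> ?\<B>" and bij: "bij_betw \<Phi> X Y"
    and shX: "shift ` X \<subseteq> X" and mX: "measure \<mu> X = 1"
    and \<Phi>: "\<Phi> \<in> measurable (restrict_space (subshift_borel A) X) (restrict_space (subshift_borel A) Y)"
    and \<Phi>': "inv_into X \<Phi> \<in>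
          measurable (restrict_space (subshift_borel A) Y) (restrict_space (subshift_borel A) X)"
    and comm_all: "\<forall>\<omega>\<in>X. \<Phi> (shift \<omega>) = shift (\<Phi> \<omega>)"
    and pres_all: "\<forall>B\<in>?\<B>. B \<subseteq> X \<longrightarrow> measure \<mu> B = measure \<nu> (\<Phi> ` B)"
    using assms(3) unfolding isomorphic_systems_def by (elim bexE exE conjE) (rule that; assumption)
  have comm: "\<Phi> (shift \<omega>) = shift (\<Phi> \<omega>)" if "\<omega> \<in> X" for \<omega>
    using comm_all that by (rule bspec)
  have pres: "measure \<mu> B = measure \<nu> (\<Phi> ` B)" if "B \<in> ?\<B>" "B \<subseteq> X" for B
    using pres_all that by blast
  have XS: "X \<subseteq> subshift A" and YS: "Y \<subseteq> subshift A"
    using X Y by (metis sets.sets_into_space space_subshift_borel)+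
  have inj: "inj_on \<Phi> X" and \<Phi>X: "\<Phi> ` X = Y" using bij by (auto simp: bij_betw_def)
  have shX': "(shift ^^ n) \<omega> \<in> X" if "\<omega> \<in> X" for n \<omega>
    using that shX by (induction n) auto
  have comm': "\<Phi> ((shift ^^ n) \<omega>) = (shift ^^ n) (\<Phi> \<omega>)" if "\<omega> \<in> X" for n \<omega>
    using that comm shX' by (induction n) auto
  \<comment> \<open>Images under \<open>\<Phi>\<close> are preimages under its inverse, whose
    measurability is part of the isomorphism.\<close>
  have \<Phi>_image: "\<Phi> ` B \<in> ?\<B>" if "B \<in> ?\<B>" "B \<subseteq> X" for B
  proof -
    have "inv_into X \<Phi> -` B \<inter> space (restrict_space (subshift_borel A) Y)
        \<in> sets (restrict_space (subshift_borel A) Y)"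
      using that X by (intro measurable_sets[OF \<Phi>']) (auto simp: sets_restrict_space_iff space_subshift_borel)
    also have "inv_into X \<Phi> -` B \<inter> space (restrict_space (subshift_borel A) Y) = \<Phi> ` B"
    proof (intro equalityI subsetI)
      fix y assume "y \<in> inv_into X \<Phi> -` B \<inter> space (restrict_space (subshift_borel A) Y)"
      then have "inv_into X \<Phi> y \<in> B" "y \<in> \<Phi> ` X" by (auto simp: space_restrict_space \<Phi>X)
      then show "y \<in> \<Phi> ` B" by (metis f_inv_into_f image_eqI)
    next
      fix y assume "y \<in> \<Phi> ` B"
      then show "y \<in> inv_into X \<Phi> -` B \<inter> space (restrict_space (subshift_borel A) Y)"
        using that YS \<Phi>X inj by (auto simp: space_restrict_space space_subshift_borel)
    qed
    finally show ?thesis using Y by (simp add: sets_restrict_space_iff space_subshift_borel)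
  qed
  define c where "c p = {\<omega> \<in> subshift A. pref n \<omega> = p}" for p
  have c_sets: "c p \<in> ?\<B>" for p unfolding c_def by (rule subshift_cylinder_Collect)
  have c_cyl: "c (pref n \<omega>) = cylinder A n \<omega>" for \<omega> by (simp add: c_def cylinder_pref)
  define B where "B p q = {\<omega> \<in> X. pref n \<omega> = p \<and> pref n (\<Phi> \<omega>) = q}" for p q
  define S where "S p q = (shift ^^ n) ` B p q" for p q
  have B_sets: "B p q \<in> ?\<B>" for p q
  proof -
    have "\<Phi> -` (c q \<inter> Y) \<inter> space (restrict_space (subshift_borel A) X)
        \<in> sets (restrict_space (subshift_borel A) X)"
      using c_sets Y by (intro measurable_sets[OF \<Phi>]) (auto simp: sets_restrict_space_iff space_subshift_borel)
    then have "\<Phi> -` (c q \<inter> Y) \<inter> space (restrict_space (subshift_borel A) X) \<in> ?\<B>"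
      using X by (simp add: sets_restrict_space_iff space_subshift_borel)
    moreover have "B p q = c p \<inter> (\<Phi> -` (c q \<inter> Y) \<inter> space (restrict_space (subshift_borel A) X))"
      using XS YS \<Phi>X by (auto simp: B_def c_def space_restrict_space space_subshift_borel)
    ultimately show ?thesis using c_sets by auto
  qed
  have B_sub: "B p q \<subseteq> X" "B p q \<subseteq> c p" "\<Phi> ` B p q \<subseteq> c q" for p q
    using XS YS \<Phi>X by (auto simp: B_def c_def)
  have S_sets: "S p q \<in> ?\<B>" if "p \<in> pref n ` subshift A" for p q
    using that B_sets B_sub(2)[of p q] c_cyl unfolding S_def by (auto intro!: shift_image_in_sets)
  have S_sub: "S p q \<subseteq> X" for p q using subsetD[OF B_sub(1)] shX' by (auto simp: S_def)
  have \<Phi>S: "\<Phi> ` S p q = (shift ^^ n) ` \<Phi> ` B p q" for p q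
    using comm' B_sub(1)[of p q] by (auto simp: S_def image_image intro!: image_cong)
  define V where "V = info_words A \<mu> n x e"
  define W where "W = info_words A \<nu> n x (e + K + L)"
  have V_sub: "V \<subseteq> pref n ` subshift A" and fin: "finite V" "finite W"
    by (simp_all add: V_def W_def info_words_subset finite_info_words)
  \<comment> \<open>If \<open>S p q\<close> is not null, then comparing \<open>B p q\<close> with
    \<open>S p q\<close> in the first system, and their equally large images in the second, shows
    that the cylinders of \<open>p\<close> and \<open>q\<close> have the same measure up to the
    factor \<open>exp (K + L)\<close>. So \<open>p\<close> in \<open>V\<close> forces
    \<open>q\<close> into \<open>W\<close>.\<close>
  have S_null: "measure \<mu> (S p q) = 0" if p: "p \<in> V" and q: "q \<in> pref n ` subshift A" "q \<notin> W" for p q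
  proof (rule ccontr)
    assume "measure \<mu> (S p q) \<noteq> 0"
    then have pos: "0 < measure \<mu> (S p q)" using measure_nonneg[of \<mu> "S p q"] by linarith
    obtain \<omega> where \<omega>: "\<omega> \<in> subshift A" "p = pref n \<omega>" "\<bar>cyl_info A \<mu> n \<omega> - x\<bar> \<le> e"
      using p by (auto simp: V_def info_words_def)
    obtain \<eta> where \<eta>: "\<eta> \<in> subshift A" "q = pref n \<eta>" using q by auto
    have B1: "B p q \<subseteq> cylinder A n \<omega>" "\<Phi> ` B p q \<subseteq> cylinder A n \<eta>"
      using B_sub(2,3)[of p q] by (simp_all add: \<omega> \<eta> c_cyl)
    note jM = M.quasi_jacobian[OF \<omega>(1) B_sets B1(1), folded S_def]
    note jN = N.quasi_jacobian[OF \<eta>(1) \<Phi>_image[OF B_sets B_sub(1)] B1(2), folded \<Phi>S]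
    have eqs: "measure \<nu> (\<Phi> ` B p q) = measure \<mu> (B p q)" "measure \<nu> (\<Phi> ` S p q) = measure \<mu> (S p q)"
      using pres B_sets B_sub(1) S_sets[of p q] S_sub p V_sub by auto
    let ?a = "measure \<mu> (cylinder A n \<omega>)" and ?b = "measure \<nu> (cylinder A n \<eta>)"
    have "?a * measure \<mu> (S p q) \<le> exp K * measure \<mu> (B p q)" by (rule jM)
    also have "\<dots> \<le> exp K * (exp L * ?b * measure \<mu> (S p q))"
      using jN(1) by (simp add: eqs)
    finally have 1: "?a \<le> exp (K + L) * ?b" using pos by (simp add: exp_add mult.assoc)
    have "?b * measure \<mu> (S p q) \<le> exp L * measure \<mu> (B p q)" using jN(2) by (simp add: eqs)
    also have "\<dots> \<le> exp L * (exp K * ?a * measure \<mu> (S p q))"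
      using jM(1) by simp
    finally have 2: "?b \<le> exp (K + L) * ?a" using pos by (simp add: exp_add mult_ac)
    have "\<bar>cyl_info A \<mu> n \<omega> - cyl_info A \<nu> n \<eta>\<bar> \<le> K + L"
      using 1 2 \<omega>(1) \<eta>(1) by (simp add: M.measure_cylinder N.measure_cylinder exp_add[symmetric])
    with \<omega>(3) have "\<bar>cyl_info A \<nu> n \<eta> - x\<bar> \<le> e + K + L" by linarith
    with \<eta> q(2) show False by (auto simp: W_def info_words_def)
  qed
  \<comment> \<open>The n-th iterate spreads the cylinder of \<open>p\<close>, even after removing
    the null set outside \<open>X\<close>, over measure at least \<open>exp (- K)\<close>. The sets
    \<open>S p q\<close> cover this image, and those with \<open>q\<close> outside \<open>W\<close>
    are null.\<close>
  have lower: "exp (- K) \<le> (\<Sum>q\<in>W. measure \<mu> (S p q))" if p: "p \<in> V" for p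
  proof -
    obtain \<omega> where \<omega>: "\<omega> \<in> subshift A" "p = pref n \<omega>" using p V_sub by auto
    let ?B = "X \<inter> cylinder A n \<omega>"
    have "measure \<mu> ?B = measure \<mu> (cylinder A n \<omega>)"
    proof -
      have "AE z in \<mu>. z \<in> X" using mX X M.sets_eq by (simp add: M.prob_eq_1 AE_iff_measurable)
      then show ?thesis using X by (intro M.finite_measure_eq_AE) (auto simp: M.sets_eq cylinder_in_sets)
    qed
    then have "measure \<mu> (cylinder A n \<omega>) * 1
        \<le> measure \<mu> (cylinder A n \<omega>) * (exp K * measure \<mu> ((shift ^^ n) ` ?B))"
      using M.quasi_jacobian(1)[OF \<omega>(1), of ?B n] X by (auto simp: cylinder_in_sets mult_ac)
    then have "1 \<le> exp K * measure \<mu> ((shift ^^ n) ` ?B)"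
      using M.cylinder_pos[OF \<omega>(1)] by (simp only: mult_le_cancel_left_pos)
    then have "exp (- K) \<le> measure \<mu> ((shift ^^ n) ` ?B)"
      by (simp add: exp_minus field_simps)
    also have "(shift ^^ n) ` ?B = (\<Union>q\<in>pref n ` subshift A. S p q)"
    proof -
      have "?B = (\<Union>q\<in>pref n ` subshift A. B p q)"
        using XS YS \<Phi>X by (auto simp: B_def \<omega>(2) cylinder_pref)
      then show ?thesis by (simp only: S_def image_UN)
    qed
    also have "measure \<mu> \<dots> \<le> (\<Sum>q\<in>pref n ` subshift A. measure \<mu> (S p q))"
      using p V_sub S_sets finite_words
      by (intro M.finite_measure_subadditive_finite) (auto simp: M.sets_eq)
    also have "\<dots> = (\<Sum>q\<in>W. measure \<mu> (S p q))"
      using S_null[OF p] by (intro sum.mono_neutral_right finite_words) (auto simp: W_def info_words_subset)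
    finally show ?thesis .
  qed
  \<comment> \<open>For fixed \<open>q\<close> the sets \<open>S p q\<close> are disjoint: two
    preimages of a common point have \<open>\<Phi>\<close>-images with the same first symbols
    \<open>q\<close> and the same n-th shift. These images are equal, and \<open>\<Phi>\<close> is
    injective.\<close>
  have upper: "(\<Sum>p\<in>V. measure \<mu> (S p q)) \<le> 1" for q
  proof -
    have disj: "disjoint_family_on (\<lambda>p. S p q) V"
      unfolding disjoint_family_on_def
    proof (intro ballI impI, rule ccontr)
      fix p p' assume "p \<noteq> p'" "S p q \<inter> S p' q \<noteq> {}"
      then obtain \<omega> \<omega>' where *: "\<omega> \<in> B p q" "\<omega>' \<in> B p' q" "(shift ^^ n) \<omega> = (shift ^^ n) \<omega>'"
        by (auto simp: S_def)
      then have X': "\<omega> \<in> X" "\<omega>' \<in> X" and pq: "pref n (\<Phi> \<omega>) = pref n (\<Phi> \<omega>')"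
        by (auto simp: B_def)
      then have "(shift ^^ n) (\<Phi> \<omega>) = (shift ^^ n) (\<Phi> \<omega>')" using comm' *(3) by metis
      then have "\<Phi> \<omega> (n + t) = \<Phi> \<omega>' (n + t)" for t by (simp add: funpow_shift fun_eq_iff)
      then have "\<Phi> \<omega> t = \<Phi> \<omega>' t" for t
        using pq by (cases "t < n") (auto simp: pref_eq_iff dest: le_Suc_ex simp: not_less)
      then have "\<omega> = \<omega>'" using inj X' by (auto simp: inj_on_def fun_eq_iff)
      with * \<open>p \<noteq> p'\<close> show False by (auto simp: B_def)
    qed
    have "(\<Sum>p\<in>V. measure \<mu> (S p q)) = measure \<mu> (\<Union>p\<in>V. S p q)"
      using disj fin V_sub S_sets by (intro M.finite_measure_finite_Union[symmetric]) (auto simp: M.sets_eq)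
    then show ?thesis by simp
  qed
  have "real (card V) * exp (- K) = (\<Sum>p\<in>V. exp (- K))" by simp
  also have "\<dots> \<le> (\<Sum>p\<in>V. \<Sum>q\<in>W. measure \<mu> (S p q))" by (intro sum_mono lower)
  also have "\<dots> = (\<Sum>q\<in>W. \<Sum>p\<in>V. measure \<mu> (S p q))" by (rule sum.swap)
  also have "\<dots> \<le> (\<Sum>q\<in>W. 1)" by (intro sum_mono upper)
  finally show ?thesis by (simp add: V_def W_def exp_minus field_simps)
qed

section \<open>Covers and mass distributions\<close>

text \<open>Bridges countable subadditivity, stated for series, and the unordered sums in the
  definition of the entropy.\<close>

lemma countable_cover_emeasure_le:
  assumes F: "countable F" and D: "\<And>i. i \<in> F \<Longrightarrow> D i \<in> sets P"
  shows "emeasure P (\<Union>i\<in>F. D i) \<le> (\<Sum>\<^sub>\<infinity>i\<in>F. emeasure P (D i))"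
proof (cases "finite F")
  case True
  then show ?thesis using D by (auto intro!: emeasure_subadditive_finite)
next
  case False
  define h where "h = from_nat_into F"
  have h: "bij_betw h UNIV F" unfolding h_def by (rule bij_betw_from_nat_into[OF F False])
  then have hF: "range h = F" by (simp add: bij_betw_def)
  have "emeasure P (\<Union>i\<in>F. D i) = emeasure P (\<Union>n. D (h n))"
    unfolding hF[symmetric] image_image ..
  also have "\<dots> \<le> (\<Sum>n. emeasure P (D (h n)))"
    using D hF by (intro emeasure_subadditive_countably) auto
  also have "\<dots> = (\<Sum>\<^sub>\<infinity>n. emeasure P (D (h n)))"
    by (rule sums_unique[symmetric, OF has_sum_imp_sums[OF has_sum_infsum]])
      (rule nonneg_summable_on_complete, simp)
  also have "\<dots> = (\<Sum>\<^sub>\<infinity>i\<in>F. emeasure P (D i))"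
    by (rule infsum_reindex_bij_betw[OF h])
  finally show ?thesis .
qed

definition bowen_exponents :: "nat mat \<Rightarrow> (nat \<Rightarrow> nat) set \<Rightarrow> real set" where
  "bowen_exponents A Z = {s. 0 \<le> s \<and>
       (\<lambda>n. INF F\<in>cylinder_covers A n Z. \<Sum>\<^sub>\<infinity>(m, \<omega>)\<in>F. ennreal (exp (- s * real m)))
         \<longlonglongrightarrow> 0}"

lemma bowen_entropy_eq: "bowen_entropy A Z = Inf (bowen_exponents A Z)"
  by (simp add: bowen_entropy_def bowen_exponents_def)

lemma bowen_entropy_le: "s \<in> bowen_exponents A Z \<Longrightarrow> bowen_entropy A Z \<le> s"
  unfolding bowen_entropy_eq
  by (rule cInf_lower) (auto simp: bowen_exponents_def intro!: bdd_belowI[of _ 0])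

text \<open>If s < t, a cover of \<open>Z\<close> by long cylinders with sum below 1 would capture
  less than the total mass 1. The measure lives on a space of codes, and preimages of cylinders are
  merely enclosed in measurable sets \<open>D\<close>, so neither \<open>code\<close> nor
  \<open>Z\<close> has to be shown measurable.\<close>

lemma mass_distribution_principle:
  fixes P :: "'x measure"
  assumes P: "prob_space P" and code: "\<And>x. x \<in> space P \<Longrightarrow> code x \<in> Z"
    and mass: "\<And>n \<omega>. n \<ge> n0 \<Longrightarrow> \<omega> \<in> subshift A \<Longrightarrow>
      \<exists>D\<in>sets P. {x \<in> space P. code x \<in> cylinder A n \<omega>} \<subseteq> D \<and>
        emeasure P D \<le> ennreal (exp (- t * real n))"
    and s: "s \<in> bowen_exponents A Z"
  shows "t \<le> s"
proof (rule ccontr)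
  assume "\<not> t \<le> s"
  interpret prob_space P by (rule P)
  have "\<forall>\<^sub>F n in sequentially.
      (INF F\<in>cylinder_covers A n Z. \<Sum>\<^sub>\<infinity>(m, \<omega>)\<in>F. ennreal (exp (- s * real m))) < 1"
    using s unfolding bowen_exponents_def by (intro order_tendstoD(2)[of _ 0]) auto
  then have "\<forall>\<^sub>F n in sequentially. n \<ge> n0 \<and>
      (INF F\<in>cylinder_covers A n Z. \<Sum>\<^sub>\<infinity>(m, \<omega>)\<in>F. ennreal (exp (- s * real m))) < 1"
    by (intro eventually_conj eventually_ge_at_top)
  then obtain n where n: "n \<ge> n0"
    and "(INF F\<in>cylinder_covers A n Z. \<Sum>\<^sub>\<infinity>(m, \<omega>)\<in>F. ennreal (exp (- s * real m))) < 1"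
    using eventually_happens'[OF sequentially_bot] by blast
  then obtain F where F: "F \<in> cylinder_covers A n Z"
    and F1: "(\<Sum>\<^sub>\<infinity>(m, \<omega>)\<in>F. ennreal (exp (- s * real m))) < 1"
    unfolding INF_less_iff by blast
  from F have cF: "countable F" and subF: "F \<subseteq> {n..} \<times> subshift A"
    and cover: "Z \<subseteq> (\<Union>(m, \<omega>)\<in>F. cylinder A m \<omega>)"
    unfolding cylinder_covers_def by blast+
  have "\<forall>i\<in>F. \<exists>D. D \<in> sets P \<and> {x \<in> space P. code x \<in> cylinder A (fst i) (snd i)} \<subseteq> D \<and>
        emeasure P D \<le> ennreal (exp (- t * real (fst i)))"
  proof
    fix i assume "i \<in> F"
    then have "n0 \<le> fst i" "snd i \<in> subshift A" using subF n by auto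
    from mass[OF this] show "\<exists>D. D \<in> sets P \<and>
        {x \<in> space P. code x \<in> cylinder A (fst i) (snd i)} \<subseteq> D \<and>
        emeasure P D \<le> ennreal (exp (- t * real (fst i)))" by blast
  qed
  from bchoice[OF this] obtain D where D: "\<And>i. i \<in> F \<Longrightarrow> D i \<in> sets P"
    and D_sup: "\<And>i. i \<in> F \<Longrightarrow> {x \<in> space P. code x \<in> cylinder A (fst i) (snd i)} \<subseteq> D i"
    and D_le: "\<And>i. i \<in> F \<Longrightarrow> emeasure P (D i) \<le> ennreal (exp (- t * real (fst i)))"
    by blast
  have "space P \<subseteq> (\<Union>i\<in>F. D i)"
  proof
    fix x assume x: "x \<in> space P"
    with code cover obtain i where "i \<in> F" "code x \<in> cylinder A (fst i) (snd i)" by fastforce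
    with D_sup x show "x \<in> (\<Union>i\<in>F. D i)" by blast
  qed
  moreover have "(\<Union>i\<in>F. D i) \<in> sets P" using D cF by (intro sets.countable_UN') auto
  ultimately have "1 \<le> emeasure P (\<Union>i\<in>F. D i)"
    using emeasure_mono[of "space P" "\<Union>i\<in>F. D i" P] by (simp add: emeasure_space_1)
  also have "\<dots> \<le> (\<Sum>\<^sub>\<infinity>i\<in>F. emeasure P (D i))"
    by (rule countable_cover_emeasure_le[OF cF D])
  also have "\<dots> \<le> (\<Sum>\<^sub>\<infinity>i\<in>F. ennreal (exp (- s * real (fst i))))"
  proof (rule infsum_mono)
    fix i assume "i \<in> F"
    then have "emeasure P (D i) \<le> ennreal (exp (- t * real (fst i)))" by (rule D_le)
    also have "\<dots> \<le> ennreal (exp (- s * real (fst i)))"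
      using \<open>\<not> t \<le> s\<close> by (intro ennreal_leI) (simp add: mult_right_mono)
    finally show "emeasure P (D i) \<le> ennreal (exp (- s * real (fst i)))" .
  qed (rule nonneg_summable_on_complete, simp)+
  also have "\<dots> < 1" using F1 by (simp add: case_prod_unfold)
  finally show False by simp
qed

lemma sum_power_tail_le:
  fixes q :: real
  assumes "0 \<le> q" "q < 1"
  shows "(\<Sum>m=n..<M. q ^ m) \<le> q ^ n / (1 - q)"
proof (cases "n \<le> M")
  case True
  then have "(1 - q) * (\<Sum>m=n..<M. q ^ m) = q ^ n - q ^ M"
  proof (induction rule: dec_induct)
    case (step m)
    then show ?case by (simp add: distrib_left) (simp add: algebra_simps)
  qed simp
  also have "\<dots> \<le> q ^ n" using assms by simp
  finally show ?thesis using assms by (simp add: pos_le_divide_eq mult.commute)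
qed (use assms in auto)

text \<open>A single tolerance suffices: every point of the level set has words within \<epsilon> of
  \<alpha> at all large lengths. The words of length m then contribute at most \<open>q ^ m\<close>,
  a geometric series.\<close>

lemma level_set_exponents:
  assumes "0 < \<epsilon>" "0 \<le> s'" "s < s'"
    and card: "\<And>n. n \<ge> n0 \<Longrightarrow>
      real (card (info_words A \<mu> n (\<alpha> * real n) (\<epsilon> * real n))) \<le> exp (s * real n)"
  shows "s' \<in> bowen_exponents A (level_set A \<mu> \<alpha>)"
proof -
  define q where "q = exp (- (s' - s))"
  have q: "0 < q" "q < 1" using assms by (simp_all add: q_def)
  define V where "V m = info_words A \<mu> m (\<alpha> * real m) (\<epsilon> * real m)" for m
  have "\<exists>r. \<forall>m. \<forall>p\<in>V m. r m p \<in> subshift A \<and> pref m (r m p) = p"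
  proof -
    have "\<forall>m. \<forall>p\<in>V m. \<exists>\<omega>. \<omega> \<in> subshift A \<and> pref m \<omega> = p"
      unfolding V_def info_words_def by blast
    then show ?thesis by metis
  qed
  then obtain r where r: "\<And>m p. p \<in> V m \<Longrightarrow> r m p \<in> subshift A"
    "\<And>m p. p \<in> V m \<Longrightarrow> pref m (r m p) = p" by blast
  have finV: "finite (V m)" for m by (simp add: V_def finite_info_words)
  have le: "(INF F\<in>cylinder_covers A n (level_set A \<mu> \<alpha>). \<Sum>\<^sub>\<infinity>(m, \<omega>)\<in>F. ennreal (exp (- s' * real m)))
      \<le> ennreal (q ^ n / (1 - q))" if n: "n \<ge> n0" for n
  proof -
    \<comment> \<open>All lengths from \<open>n\<close> on are used at once, since the length from
      which the average is within \<epsilon> of \<alpha> is not uniform over the level set.\<close>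
    define F where "F = (SIGMA m:{n..}. r m ` V m)"
    have "level_set A \<mu> \<alpha> \<subseteq> (\<Union>(m, \<omega>)\<in>F. cylinder A m \<omega>)"
    proof
      fix \<omega> assume "\<omega> \<in> level_set A \<mu> \<alpha>"
      then have \<omega>: "\<omega> \<in> subshift A"
        and lim: "(\<lambda>m. - (1 / real m) * ln (measure \<mu> (cylinder A m \<omega>))) \<longlonglongrightarrow> \<alpha>"
        by (auto simp: level_set_def)
      have "\<forall>\<^sub>F m in sequentially.
          dist (- (1 / real m) * ln (measure \<mu> (cylinder A m \<omega>))) \<alpha> < \<epsilon> \<and> m \<ge> max n 1"
        using lim \<open>0 < \<epsilon>\<close> by (intro eventually_conj tendstoD eventually_ge_at_top)
      then obtain m where "dist (- (1 / real m) * ln (measure \<mu> (cylinder A m \<omega>))) \<alpha> < \<epsilon>"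
        and m: "m \<ge> max n 1"
        using eventually_happens'[OF sequentially_bot] by blast
      then have *: "\<bar>cyl_info A \<mu> m \<omega> / real m - \<alpha>\<bar> < \<epsilon>" by (simp add: dist_real_def cyl_info_def)
      have "cyl_info A \<mu> m \<omega> - \<alpha> * real m = (cyl_info A \<mu> m \<omega> / real m - \<alpha>) * real m"
        using m by (simp add: left_diff_distrib)
      then have "\<bar>cyl_info A \<mu> m \<omega> - \<alpha> * real m\<bar> = \<bar>cyl_info A \<mu> m \<omega> / real m - \<alpha>\<bar> * real m"
        by (simp add: abs_mult)
      also have "\<dots> \<le> \<epsilon> * real m" using * m by (intro mult_right_mono) auto
      finally have "pref m \<omega> \<in> V m" using \<omega> unfolding V_def info_words_def by blast
      moreover from r(2)[OF this] have "\<omega> \<in> cylinder A m (r m (pref m \<omega>))"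
        using \<omega> by (simp add: cylinder_pref)
      ultimately show "\<omega> \<in> (\<Union>(m, \<omega>)\<in>F. cylinder A m \<omega>)" using m by (force simp: F_def)
    qed
    moreover have "countable F" unfolding F_def using finV by (intro countable_SIGMA) (auto intro: countable_finite)
    ultimately have F: "F \<in> cylinder_covers A n (level_set A \<mu> \<alpha>)"
      using r(1) by (auto simp: cylinder_covers_def F_def)
    have "(\<Sum>\<^sub>\<infinity>(m, \<omega>)\<in>F. ennreal (exp (- s' * real m))) \<le> ennreal (q ^ n / (1 - q))"
    proof (rule infsum_le_finite_sums)
      show "(\<lambda>(m, \<omega>). ennreal (exp (- s' * real m))) summable_on F"
        by (rule nonneg_summable_on_complete) simp
      fix G assume G: "finite G" "G \<subseteq> F"
      define M where "M = Suc (Max (insert 0 (fst ` G)))"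
      have "fst i < M" if "i \<in> G" for i
        using that G by (simp add: M_def less_Suc_eq_le)
      then have "G \<subseteq> (SIGMA m:{n..<M}. r m ` V m)" using G by (fastforce simp: F_def)
      then have "(\<Sum>(m, \<omega>)\<in>G. ennreal (exp (- s' * real m)))
          \<le> (\<Sum>(m, \<omega>)\<in>(SIGMA m:{n..<M}. r m ` V m). ennreal (exp (- s' * real m)))"
        using finV by (intro sum_mono2) auto
      also have "\<dots> = (\<Sum>m=n..<M. \<Sum>\<omega>\<in>r m ` V m. ennreal (exp (- s' * real m)))"
        using finV by (subst sum.Sigma) auto
      also have "\<dots> \<le> (\<Sum>m=n..<M. ennreal (q ^ m))"
      proof (rule sum_mono)
        fix m assume m: "m \<in> {n..<M}"
        have "real (card (r m ` V m)) \<le> exp (s * real m)"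
          using card_image_le[OF finV, of "r m" m] card[of m] m n by (simp add: V_def)
        then have "real (card (r m ` V m)) * exp (- s' * real m) \<le> exp (s * real m) * exp (- s' * real m)"
          by (rule mult_right_mono) simp
        also have "\<dots> = q ^ m"
          by (simp add: q_def exp_of_nat_mult[symmetric] exp_add[symmetric] algebra_simps)
        finally have "ennreal (real (card (r m ` V m)) * exp (- s' * real m)) \<le> ennreal (q ^ m)"
          by (rule ennreal_leI)
        then show "(\<Sum>\<omega>\<in>r m ` V m. ennreal (exp (- s' * real m))) \<le> ennreal (q ^ m)"
          by (simp add: ennreal_mult ennreal_of_nat_eq_real_of_nat)
      qed
      also have "\<dots> = ennreal (\<Sum>m=n..<M. q ^ m)" using q by (intro sum_ennreal) simp
      also have "\<dots> \<le> ennreal (q ^ n / (1 - q))" using q by (intro ennreal_leI sum_power_tail_le) auto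
      finally show "(\<Sum>(m, \<omega>)\<in>G. ennreal (exp (- s' * real m))) \<le> ennreal (q ^ n / (1 - q))" .
    qed
    then show ?thesis by (rule INF_lower2[OF F])
  qed
  have "(\<lambda>n. ennreal (q ^ n / (1 - q))) \<longlonglongrightarrow> ennreal (0 / (1 - q))"
    using q by (intro tendsto_ennrealI tendsto_divide tendsto_const LIMSEQ_power_zero) auto
  then have lim0: "(\<lambda>n. ennreal (q ^ n / (1 - q))) \<longlonglongrightarrow> 0" by simp
  have "\<forall>\<^sub>F n in sequentially. (INF F\<in>cylinder_covers A n (level_set A \<mu> \<alpha>).
      \<Sum>\<^sub>\<infinity>(m, \<omega>)\<in>F. ennreal (exp (- s' * real m))) \<le> ennreal (q ^ n / (1 - q))"
    using le by (rule eventually_sequentiallyI)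
  then have "(\<lambda>n. INF F\<in>cylinder_covers A n (level_set A \<mu> \<alpha>).
      \<Sum>\<^sub>\<infinity>(m, \<omega>)\<in>F. ennreal (exp (- s' * real m))) \<longlonglongrightarrow> 0"
    by (intro tendsto_sandwich[OF _ _ tendsto_const lim0]) auto
  with \<open>0 \<le> s'\<close> show ?thesis unfolding bowen_exponents_def by blast
qed

text \<open>The infimum of the empty set of reals is unspecified, so lower bounds on the entropy
  require this. The number of all words is bound enough; \<open>Suc\<close> keeps the argument of
  the logarithm positive.\<close>

lemma level_set_exponents_nonempty: "bowen_exponents A (level_set A \<mu> \<alpha>) \<noteq> {}"
proof -
  define s where "s = ln (real (Suc (dim_row A)))"
  have "real (card (info_words A \<mu> n (\<alpha> * real n) (1 * real n))) \<le> exp (s * real n)" for n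
  proof -
    have "card (info_words A \<mu> n (\<alpha> * real n) (1 * real n)) \<le> dim_row A ^ n"
      using card_mono[OF finite_words info_words_subset] card_words_le by (rule order_trans)
    also have "\<dots> \<le> Suc (dim_row A) ^ n" by (rule power_mono) auto
    finally have "real (card (info_words A \<mu> n (\<alpha> * real n) (1 * real n))) \<le> real (Suc (dim_row A)) ^ n"
      unfolding of_nat_power[symmetric] of_nat_le_iff .
    also have "\<dots> = exp (s * real n)" by (simp add: s_def exp_of_nat2_mult)
    finally show ?thesis .
  qed
  moreover have "0 \<le> s" by (simp add: s_def)
  ultimately have "s + 1 \<in> bowen_exponents A (level_set A \<mu> \<alpha>)"
    by (intro level_set_exponents[of 1 _ s]) auto
  then show ?thesis by blast
qed

section \<open>Concatenation of loops\<close>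

text \<open>Throughout, \<open>l i\<close> is the length of the \<open>i\<close>-th block.\<close>

definition block_start :: "(nat \<Rightarrow> nat) \<Rightarrow> nat \<Rightarrow> nat" where
  "block_start l i = (\<Sum>j<i. l j)"

definition block_index :: "(nat \<Rightarrow> nat) \<Rightarrow> nat \<Rightarrow> nat" where
  "block_index l n = (LEAST i. n < block_start l (Suc i))"

definition concat_blocks :: "(nat \<Rightarrow> nat) \<Rightarrow> (nat \<Rightarrow> nat list) \<Rightarrow> nat \<Rightarrow> nat" where
  "concat_blocks l x n = x (block_index l n) ! (n - block_start l (block_index l n))"

lemma block_start_0 [simp]: "block_start l 0 = 0"
  by (simp add: block_start_def)

lemma block_start_Suc [simp]: "block_start l (Suc i) = block_start l i + l i"
  by (simp add: block_start_def)

lemma block_start_mono: "i \<le> j \<Longrightarrow> block_start l i \<le> block_start l j"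
  unfolding block_start_def by (rule sum_mono2) auto

lemma block_start_ge:
  assumes "\<And>i. 0 < l i"
  shows "i \<le> block_start l i"
proof (induction i)
  case (Suc i)
  then show ?case using assms[of i] by simp
qed simp

lemma block_index_eq:
  assumes "block_start l i \<le> n" "n < block_start l (Suc i)"
  shows "block_index l n = i"
  unfolding block_index_def
proof (rule Least_equality)
  fix j assume "n < block_start l (Suc j)"
  with assms(1) have "\<not> block_start l (Suc j) \<le> block_start l i" by simp
  then show "i \<le> j" using block_start_mono[of "Suc j" i l] by (meson not_less_eq_eq)
qed (rule assms)

lemma block_index_bounds:
  assumes "\<And>i. 0 < l i"
  shows "block_start l (block_index l n) \<le> n" "n < block_start l (Suc (block_index l n))"
proof -
  have "n < block_start l (Suc n)" using block_start_ge[of l "Suc n"] assms by simp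
  then show "n < block_start l (Suc (block_index l n))"
    unfolding block_index_def by (rule LeastI)
  show "block_start l (block_index l n) \<le> n"
  proof (cases "block_index l n")
    case (Suc i)
    then have "\<not> n < block_start l (Suc i)" unfolding block_index_def by (metis lessI not_less_Least)
    with Suc show ?thesis by simp
  qed simp
qed

lemma filterlim_block_index:
  assumes "\<And>i. 0 < l i"
  shows "filterlim (block_index l) at_top sequentially"
  unfolding filterlim_at_top
proof
  fix b
  have "b \<le> block_index l n" if "block_start l b \<le> n" for n
  proof (rule ccontr)
    assume "\<not> b \<le> block_index l n"
    then have "block_start l (Suc (block_index l n)) \<le> block_start l b"
      by (intro block_start_mono) simp
    with block_index_bounds(2)[of l n] assms that show False by simp
  qed
  then show "\<forall>\<^sub>F n in sequentially. b \<le> block_index l n"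
    by (auto simp: eventually_sequentially)
qed

lemma concat_blocks_nth:
  assumes "t < l i"
  shows "concat_blocks l x (block_start l i + t) = x i ! t"
  using block_index_eq[of l i "block_start l i + t"] assms by (simp add: concat_blocks_def)

text \<open>The closing symbol \<open>a\<close> at position \<open>n\<close> is not part of the
  word. It is the first symbol of the next loop, so concatenation is plain juxtaposition.\<close>

definition loop_words :: "nat mat \<Rightarrow> nat \<Rightarrow> nat \<Rightarrow> nat list set" where
  "loop_words A a n = {pref n \<omega> | \<omega>. \<omega> \<in> subshift A \<and> \<omega> 0 = a \<and> \<omega> n = a}"

lemma concat_blocks_in_subshift:
  assumes l: "\<And>i. 0 < l i" and x: "\<And>i. x i \<in> loop_words A a (l i)"
  shows "concat_blocks l x \<in> subshift A"
  unfolding subshift_def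
proof (intro CollectI allI)
  fix n
  define i where "i = block_index l n"
  define t where "t = n - block_start l i"
  have n: "n = block_start l i + t" and t: "t < l i"
    using block_index_bounds[of l n] l by (simp_all add: i_def t_def)
  obtain \<omega> where \<omega>: "\<omega> \<in> subshift A" "\<omega> (l i) = a" "x i = pref (l i) \<omega>"
    using x[of i] by (auto simp: loop_words_def)
  obtain \<omega>' where \<omega>': "\<omega>' 0 = a" "x (Suc i) = pref (l (Suc i)) \<omega>'"
    using x[of "Suc i"] by (auto simp: loop_words_def)
  have "concat_blocks l x n = \<omega> t" using concat_blocks_nth[of t l i x] t n \<omega> by simp
  moreover have "concat_blocks l x (Suc n) = \<omega> (Suc t)"
  proof (cases "Suc t < l i")
    case True
    then show ?thesis using concat_blocks_nth[of "Suc t" l i x] n \<omega> by simp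
  next
    case False
    \<comment> \<open>At a seam the next symbol is the initial \<open>a\<close> of the following
      block, and this is the symbol with which the present loop closes.\<close>
    with t have t': "Suc t = l i" by simp
    then have "Suc n = block_start l (Suc i) + 0" using n by simp
    then have "concat_blocks l x (Suc n) = x (Suc i) ! 0"
      using concat_blocks_nth[of 0 l "Suc i" x] l[of "Suc i"] by simp
    also have "\<dots> = \<omega> (Suc t)" using l[of "Suc i"] \<omega>(2) \<omega>' t' by simp
    finally show ?thesis .
  qed
  ultimately show "concat_blocks l x n \<in> {1..dim_row A} \<and>
      A $$ (concat_blocks l x n - 1, concat_blocks l x (Suc n) - 1) = 1"
    using \<omega>(1) by (auto simp: subshift_def)
qed

lemma pref_shift_concat_blocks:
  assumes "length (x i) = l i"
  shows "pref (l i) ((shift ^^ block_start l i) (concat_blocks l x)) = x i"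
  by (rule nth_equalityI) (auto simp: assms funpow_shift concat_blocks_nth)

text \<open>A weighted Cesaro mean: the early terms are fixed while the total weight grows, and the
  later ones form a small fraction of it.\<close>

lemma weighted_average_tendsto_0:
  fixes e :: "nat \<Rightarrow> real"
  assumes l: "\<And>i. 0 < l i" and e: "e \<longlonglongrightarrow> 0"
  shows "(\<lambda>b. (\<Sum>i<b. e i * real (l i)) / real (block_start l b)) \<longlonglongrightarrow> 0"
proof (rule LIMSEQ_I)
  fix r :: real assume r: "0 < r"
  obtain i0 where i0: "\<And>i. i \<ge> i0 \<Longrightarrow> \<bar>e i\<bar> < r / 2"
    using LIMSEQ_D[OF e, of "r / 2"] r by auto
  define c where "c = (\<Sum>i<i0. \<bar>e i\<bar> * real (l i))"
  have bound: "(\<Sum>i<b. \<bar>e i\<bar> * real (l i)) \<le> c + r / 2 * real (block_start l b)" if "b \<ge> i0" for b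
    using that
  proof (induction rule: dec_induct)
    case base
    then show ?case using r by (simp add: c_def)
  next
    case (step b)
    have "\<bar>e b\<bar> * real (l b) \<le> r / 2 * real (l b)" using i0[of b] step by (intro mult_right_mono) auto
    with step.IH show ?case by (simp add: algebra_simps)
  qed
  obtain b0 :: nat where b0: "2 * c / r < real b0" using reals_Archimedean2 by blast
  have "norm ((\<Sum>i<b. e i * real (l i)) / real (block_start l b) - 0) < r" if b: "b \<ge> max (max i0 b0) 1" for b
  proof -
    have ge: "b \<le> block_start l b" using l by (rule block_start_ge)
    have "2 * c / r < real (block_start l b)" using b0 ge b by linarith
    then have "c < r / 2 * real (block_start l b)" using r by (simp add: field_simps)
    moreover have "\<bar>\<Sum>i<b. e i * real (l i)\<bar> \<le> (\<Sum>i<b. \<bar>e i\<bar> * real (l i))"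
      using sum_abs[of "\<lambda>i. e i * real (l i)" "{..<b}"] by (simp add: abs_mult)
    moreover have "\<dots> \<le> c + r / 2 * real (block_start l b)" using b by (intro bound) simp
    ultimately have "\<bar>\<Sum>i<b. e i * real (l i)\<bar> < r * real (block_start l b)" by (simp add: field_simps)
    moreover have "0 < real (block_start l b)" using ge b by simp
    ultimately show ?thesis by (simp add: divide_less_eq)
  qed
  then show "\<exists>no. \<forall>n\<ge>no. norm ((\<Sum>i<n. e i * real (l i)) / real (block_start l n) - 0) < r" by blast
qed

context quasi_bernoulli
begin

lemma cyl_info_nonneg: "\<omega> \<in> subshift A \<Longrightarrow> 0 \<le> cyl_info A \<mu> n \<omega>"
  using cylinder_pos[of \<omega> n] by (simp add: cyl_info_def)

lemma cyl_info_0 [simp]: "cyl_info A \<mu> 0 \<omega> = 0"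
  by (simp add: cyl_info_def cylinder_0 space_eq[symmetric] prob_space)

lemma K_nonneg: "0 \<le> K"
proof -
  obtain \<omega> where "\<omega> \<in> subshift A" using not_empty space_eq by auto
  from quasi_additive[OF this, of 0 0] show ?thesis by simp
qed

lemma cyl_info_bounded: "\<exists>D\<ge>0. \<forall>\<omega>\<in>subshift A. cyl_info A \<mu> n \<omega> \<le> D"
proof -
  define r where "r p = inv_into (subshift A) (pref n) p" for p
  define D where "D = Max (insert 0 ((\<lambda>p. cyl_info A \<mu> n (r p)) ` pref n ` subshift A))"
  have fin: "finite (insert 0 ((\<lambda>p. cyl_info A \<mu> n (r p)) ` pref n ` subshift A))"
    using finite_words by simp
  have "cyl_info A \<mu> n \<omega> \<le> D" if "\<omega> \<in> subshift A" for \<omega>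
  proof -
    have "pref n (r (pref n \<omega>)) = pref n \<omega>"
      unfolding r_def by (rule f_inv_into_f[OF imageI[OF that]])
    then have "cyl_info A \<mu> n \<omega> = cyl_info A \<mu> n (r (pref n \<omega>))" by (intro cyl_info_cong) simp
    also have "\<dots> \<le> D" unfolding D_def using fin that by (intro Max_ge) auto
    finally show ?thesis .
  qed
  moreover have "0 \<le> D" unfolding D_def using fin by (intro Max_ge) auto
  ultimately show ?thesis by blast
qed

lemma cyl_info_linear_bound: "\<exists>D\<ge>0. \<forall>n. \<forall>\<omega>\<in>subshift A. cyl_info A \<mu> n \<omega> \<le> D * real n"
proof -
  obtain D where D: "0 \<le> D" "\<And>\<omega>. \<omega> \<in> subshift A \<Longrightarrow> cyl_info A \<mu> 1 \<omega> \<le> D"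
    using cyl_info_bounded[of 1] by blast
  have "cyl_info A \<mu> n \<omega> \<le> (D + K) * real n" if "\<omega> \<in> subshift A" for n \<omega>
  proof (induction n)
    case (Suc n)
    have "cyl_info A \<mu> (Suc n) \<omega> \<le> cyl_info A \<mu> n \<omega> + cyl_info A \<mu> 1 ((shift ^^ n) \<omega>) + K"
      using quasi_additive[OF that, of n 1] by simp
    also have "\<dots> \<le> (D + K) * real n + D + K"
      using Suc D(2)[OF funpow_shift_in_subshift[OF that, of n]] by linarith
    finally show ?case by (simp add: algebra_simps)
  qed simp
  with D(1) K_nonneg show ?thesis by (intro exI[of _ "D + K"]) auto
qed

lemma in_level_set_iff:
  "\<omega> \<in> level_set A \<mu> \<alpha> \<longleftrightarrow> \<omega> \<in> subshift A \<and> (\<lambda>n. cyl_info A \<mu> n \<omega> / real n) \<longlonglongrightarrow> \<alpha>"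
  using cylinder_pos by (auto simp: level_set_def cyl_info_def)

text \<open>Up to the start of a block the deviations add up to a weighted average of the
  \<open>e j\<close>. Inside the block the deviation is at most proportional to the block length,
  which \<open>slow\<close> makes negligible against everything before it.\<close>

lemma concat_blocks_in_level_set:
  assumes l: "\<And>i. 0 < l i" and x: "\<And>i. x i \<in> loop_words A a (l i)"
    and info: "\<And>i \<omega>. \<omega> \<in> subshift A \<Longrightarrow> pref (l i) \<omega> = x i \<Longrightarrow>
      \<bar>cyl_info A \<mu> (l i) \<omega> - \<alpha> * real (l i)\<bar> + K \<le> e i * real (l i)"
    and e: "e \<longlonglongrightarrow> 0" and slow: "(\<lambda>i. real (l i) / real (block_start l i)) \<longlonglongrightarrow> 0"
  shows "concat_blocks l x \<in> level_set A \<mu> \<alpha>"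
proof -
  let ?\<omega> = "concat_blocks l x" and ?T = "block_start l" and ?b = "block_index l"
  have \<omega>: "?\<omega> \<in> subshift A" using l x by (rule concat_blocks_in_subshift)
  obtain D where D: "0 \<le> D" "\<And>n \<omega>. \<omega> \<in> subshift A \<Longrightarrow> cyl_info A \<mu> n \<omega> \<le> D * real n"
    using cyl_info_linear_bound by blast
  \<comment> \<open>Each seam costs one error \<open>K\<close>, which the assumption on the blocks
    has already charged to \<open>e j * l j\<close>.\<close>
  have starts: "\<bar>cyl_info A \<mu> (?T i) ?\<omega> - \<alpha> * real (?T i)\<bar> \<le> (\<Sum>j<i. e j * real (l j))" for i
  proof (induction i)
    case (Suc i)
    let ?\<eta> = "(shift ^^ ?T i) ?\<omega>"
    have \<eta>: "?\<eta> \<in> subshift A" by (rule funpow_shift_in_subshift[OF \<omega>])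
    have "length (x i) = l i" using x[of i] by (auto simp: loop_words_def)
    then have "pref (l i) ?\<eta> = x i" by (rule pref_shift_concat_blocks)
    from info[OF \<eta> this] quasi_additive[OF \<omega>, of "?T i" "l i"] Suc show ?case
      by (simp add: distrib_left)
  qed simp
  \<comment> \<open>For an unfinished block of length \<open>l\<close>, \<open>D * l\<close> bounds
    its information, \<open>\<bar>\<alpha>\<bar> * l\<close> the change of the target value, and
    \<open>K \<le> K * l\<close> the error at the seam.\<close>
  define C where "C = D + K + \<bar>\<alpha>\<bar>"
  have bound: "\<bar>cyl_info A \<mu> n ?\<omega> / real n - \<alpha>\<bar>
      \<le> (\<Sum>j<?b n. e j * real (l j)) / real (?T (?b n)) + C * (real (l (?b n)) / real (?T (?b n)))"
    if n: "1 \<le> ?b n" for n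
  proof -
    let ?i = "?b n"
    define t where "t = n - ?T ?i"
    have nt: "n = ?T ?i + t" and t: "t \<le> l ?i"
      using block_index_bounds[of l n] l by (simp_all add: t_def)
    have T: "0 < ?T ?i" using block_start_ge[of l ?i] l n by simp
    let ?\<eta> = "(shift ^^ ?T ?i) ?\<omega>"
    have \<eta>: "?\<eta> \<in> subshift A" by (rule funpow_shift_in_subshift[OF \<omega>])
    have "cyl_info A \<mu> t ?\<eta> \<le> D * real t" by (rule D(2)[OF \<eta>])
    also have "\<dots> \<le> D * real (l ?i)" using t D(1) by (intro mult_left_mono) auto
    finally have 1: "cyl_info A \<mu> t ?\<eta> \<le> D * real (l ?i)" .
    have 2: "\<bar>\<alpha> * real t\<bar> \<le> \<bar>\<alpha>\<bar> * real (l ?i)"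
      using t by (simp add: abs_mult mult_left_mono)
    have 3: "K \<le> K * real (l ?i)" using K_nonneg l[of ?i] by (simp add: mult_le_cancel_left1)
    have "\<bar>cyl_info A \<mu> (?T ?i + t) ?\<omega> - \<alpha> * real (?T ?i + t)\<bar>
        \<le> (\<Sum>j<?i. e j * real (l j)) + C * real (l ?i)"
      using starts[of ?i] quasi_additive[OF \<omega>, of "?T ?i" t] cyl_info_nonneg[OF \<eta>, of t] 1 2 3
      unfolding C_def by (simp add: distrib_left distrib_right abs_le_iff)
    then have 4: "\<bar>cyl_info A \<mu> n ?\<omega> - \<alpha> * real n\<bar> \<le> (\<Sum>j<?i. e j * real (l j)) + C * real (l ?i)"
      using nt by simp
    have n0: "0 < n" using nt T by simp
    then have "cyl_info A \<mu> n ?\<omega> / real n - \<alpha> = (cyl_info A \<mu> n ?\<omega> - \<alpha> * real n) / real n"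
      by (simp add: diff_divide_distrib)
    then have "\<bar>cyl_info A \<mu> n ?\<omega> / real n - \<alpha>\<bar> = \<bar>cyl_info A \<mu> n ?\<omega> - \<alpha> * real n\<bar> / real n"
      by simp
    also have "\<dots> \<le> \<bar>cyl_info A \<mu> n ?\<omega> - \<alpha> * real n\<bar> / real (?T ?i)"
      using T nt by (intro divide_left_mono) auto
    also have "\<dots> \<le> ((\<Sum>j<?i. e j * real (l j)) + C * real (l ?i)) / real (?T ?i)"
      using 4 by (rule divide_right_mono) simp
    finally show ?thesis by (simp add: add_divide_distrib)
  qed
  have "(\<lambda>b. (\<Sum>j<b. e j * real (l j)) / real (?T b) + C * (real (l b) / real (?T b))) \<longlonglongrightarrow> 0 + C * 0"
    by (intro tendsto_add tendsto_mult_left weighted_average_tendsto_0 l e slow)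
  then have "(\<lambda>n. (\<Sum>j<?b n. e j * real (l j)) / real (?T (?b n)) + C * (real (l (?b n)) / real (?T (?b n)))) \<longlonglongrightarrow> 0"
    using filterlim_compose[OF _ filterlim_block_index[of l]] l by simp
  moreover have "\<forall>\<^sub>F n in sequentially. 1 \<le> ?b n"
    using filterlim_block_index[of l] l by (simp add: filterlim_at_top)
  then have "\<forall>\<^sub>F n in sequentially. norm (cyl_info A \<mu> n ?\<omega> / real n - \<alpha>)
      \<le> (\<Sum>j<?b n. e j * real (l j)) / real (?T (?b n)) + C * (real (l (?b n)) / real (?T (?b n)))"
    by eventually_elim (unfold real_norm_def, rule bound)
  ultimately have "(\<lambda>n. cyl_info A \<mu> n ?\<omega> / real n - \<alpha>) \<longlonglongrightarrow> 0"
    by (rule Lim_null_comparison[rotated])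
  then show ?thesis using \<omega> by (simp add: in_level_set_iff LIM_zero_iff)
qed

end

section \<open>Connecting words by aperiodicity\<close>

text \<open>A single \<open>k\<close> serves all pairs of symbols. Thus words of equal length can be
  closed up to loops of equal length.\<close>

definition paths_of_length :: "nat mat \<Rightarrow> nat \<Rightarrow> bool" where
  "paths_of_length A k \<longleftrightarrow> (\<forall>i\<in>{1..dim_row A}. \<forall>j\<in>{1..dim_row A}. \<exists>\<gamma>. \<gamma> 0 = i \<and> \<gamma> k = j \<and>
     (\<forall>t<k. \<gamma> t \<in> {1..dim_row A} \<and> A $$ (\<gamma> t - 1, \<gamma> (Suc t) - 1) = 1))"

text \<open>A positive entry of the product has a positive summand, which supplies the last step of
  the path. Vertices are matrix indices here, starting from 0.\<close>

lemma path_if_power_pos: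
  fixes A :: "nat mat"
  assumes A: "A \<in> carrier_mat N N" and Z: "zero_one_mat A"
    and "i < N" "j < N" "(A ^\<^sub>m k) $$ (i, j) > 0"
  shows "\<exists>\<gamma>. \<gamma> 0 = i \<and> \<gamma> k = j \<and> (\<forall>t\<le>k. \<gamma> t < N) \<and> (\<forall>t<k. A $$ (\<gamma> t, \<gamma> (Suc t)) = 1)"
  using assms(4,5)
proof (induction k arbitrary: j)
  case 0
  then have "i = j" using A \<open>i < N\<close> by (auto split: if_splits)
  then show ?case using \<open>i < N\<close> by (intro exI[of _ "\<lambda>_. i"]) simp
next
  case (Suc k)
  have Ak: "A ^\<^sub>m k \<in> carrier_mat N N" using A by simp
  have "(A ^\<^sub>m Suc k) $$ (i, j) = (\<Sum>l<N. (A ^\<^sub>m k) $$ (i, l) * A $$ (l, j))"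
    using A Ak \<open>i < N\<close> \<open>j < N\<close> by (simp add: scalar_prod_def atLeast0LessThan)
  with Suc.prems(2) have "(\<Sum>l<N. (A ^\<^sub>m k) $$ (i, l) * A $$ (l, j)) \<noteq> 0" by (metis less_irrefl)
  then obtain l where "l \<in> {..<N}" "(A ^\<^sub>m k) $$ (i, l) * A $$ (l, j) \<noteq> 0"
    by (rule sum.not_neutral_contains_not_neutral)
  then have l: "l < N" "(A ^\<^sub>m k) $$ (i, l) > 0" "A $$ (l, j) > 0" by auto
  have "A $$ (l, j) \<in> {0, 1}"
    using Z elements_matI[OF A l(1) \<open>j < N\<close> refl] unfolding zero_one_mat_def by (rule subsetD)
  with l(3) have lj: "A $$ (l, j) = 1" by simp
  from Suc.IH[OF l(1,2)] obtain \<gamma> where \<gamma>: "\<gamma> 0 = i" "\<gamma> k = l" "\<And>t. t \<le> k \<Longrightarrow> \<gamma> t < N"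
    "\<And>t. t < k \<Longrightarrow> A $$ (\<gamma> t, \<gamma> (Suc t)) = 1" by blast
  have "(\<gamma>(Suc k := j)) t < N" if "t \<le> Suc k" for t
    using that \<gamma>(3)[of t] \<open>j < N\<close> by simp
  moreover have "A $$ ((\<gamma>(Suc k := j)) t, (\<gamma>(Suc k := j)) (Suc t)) = 1" if "t < Suc k" for t
    using that \<gamma>(2) \<gamma>(4)[of t] lj by (cases "t = k") auto
  ultimately show ?case using \<gamma>(1) by (intro exI[of _ "\<gamma>(Suc k := j)"]) simp
qed

lemma paths_of_length_if_aperiodic:
  assumes A: "A \<in> carrier_mat N N" and Z: "zero_one_mat A" and "aperiodic_mat A"
  shows "\<exists>k. paths_of_length A k"
proof -
  from assms(3) A obtain k where pos: "\<And>i j. i < N \<Longrightarrow> j < N \<Longrightarrow> (A ^\<^sub>m k) $$ (i, j) > 0"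
    by (auto simp: aperiodic_mat_def)
  have "paths_of_length A k"
    unfolding paths_of_length_def
  proof (intro ballI)
    fix i j assume "i \<in> {1..dim_row A}" "j \<in> {1..dim_row A}"
    then have ij: "1 \<le> i" "i - 1 < N" "1 \<le> j" "j - 1 < N" using A by auto
    from path_if_power_pos[OF A Z ij(2,4) pos[OF ij(2,4)]] obtain \<gamma> where
      \<gamma>: "\<gamma> 0 = i - 1" "\<gamma> k = j - 1" "\<And>t. t \<le> k \<Longrightarrow> \<gamma> t < N"
      "\<And>t. t < k \<Longrightarrow> A $$ (\<gamma> t, \<gamma> (Suc t)) = 1" by blast
    show "\<exists>\<gamma>. \<gamma> 0 = i \<and> \<gamma> k = j \<and>
        (\<forall>t<k. \<gamma> t \<in> {1..dim_row A} \<and> A $$ (\<gamma> t - 1, \<gamma> (Suc t) - 1) = 1)"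
      using ij A \<gamma> by (intro exI[of _ "\<lambda>t. Suc (\<gamma> t)"]) (auto simp: Suc_le_eq)
  qed
  then show ?thesis ..
qed

lemma subshift_glue:
  assumes paths: "paths_of_length A k" and \<omega>: "\<omega> \<in> subshift A" and \<omega>': "\<omega>' \<in> subshift A"
  shows "\<exists>\<eta>\<in>subshift A. (\<forall>t\<le>n. \<eta> t = \<omega> t) \<and> (\<forall>t. \<eta> (n + k + t) = \<omega>' t)"
proof -
  have "\<omega> n \<in> {1..dim_row A}" "\<omega>' 0 \<in> {1..dim_row A}" using \<omega> \<omega>' by (auto simp: subshift_def)
  with paths obtain \<gamma> where \<gamma>: "\<gamma> 0 = \<omega> n" "\<gamma> k = \<omega>' 0"
    and \<gamma>_step: "\<And>t. t < k \<Longrightarrow> \<gamma> t \<in> {1..dim_row A} \<and> A $$ (\<gamma> t - 1, \<gamma> (Suc t) - 1) = 1"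
    unfolding paths_of_length_def by blast
  \<comment> \<open>The connecting path begins at \<open>\<omega> n\<close> and ends at
    \<open>\<omega>' 0\<close>. For \<open>k = 0\<close> these symbols coincide, so the claims about
    position \<open>n\<close> agree.\<close>
  define \<eta> where "\<eta> t = (if t \<le> n then \<omega> t else if t < n + k then \<gamma> (t - n) else \<omega>' (t - (n + k)))" for t
  have 1: "\<eta> t = \<omega> t" if "t \<le> n" for t using that by (simp add: \<eta>_def)
  have 2: "\<eta> (n + t) = \<gamma> t" if "t \<le> k" for t
    using that \<gamma> by (cases "t = 0"; cases "t = k") (auto simp: \<eta>_def)
  have 3: "\<eta> (n + k + t) = \<omega>' t" for t
    using \<gamma> by (cases "k = 0"; cases "t = 0") (auto simp: \<eta>_def)
  have "\<eta> t \<in> {1..dim_row A} \<and> A $$ (\<eta> t - 1, \<eta> (Suc t) - 1) = 1" for t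
  proof -
    consider "t < n" | "n \<le> t" "t < n + k" | "n + k \<le> t" by linarith
    then show ?thesis
    proof cases
      case 1
      then show ?thesis using \<open>\<And>t. t \<le> n \<Longrightarrow> \<eta> t = \<omega> t\<close>[of t]
          \<open>\<And>t. t \<le> n \<Longrightarrow> \<eta> t = \<omega> t\<close>[of "Suc t"] \<omega> by (simp add: subshift_def)
    next
      case 2
      then have "t = n + (t - n)" "t - n < k" by auto
      then obtain u where "t = n + u" "u < k" by blast
      then show ?thesis using \<open>\<And>t. t \<le> k \<Longrightarrow> \<eta> (n + t) = \<gamma> t\<close>[of u]
          \<open>\<And>t. t \<le> k \<Longrightarrow> \<eta> (n + t) = \<gamma> t\<close>[of "Suc u"] \<gamma>_step[of u] by simp
    next
      case 3
      then obtain u where "t = n + k + u" using le_Suc_ex by blast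
      then show ?thesis using \<open>\<And>t. \<eta> (n + k + t) = \<omega>' t\<close>[of u]
          \<open>\<And>t. \<eta> (n + k + t) = \<omega>' t\<close>[of "Suc u"] \<omega>' by (simp add: subshift_def)
    qed
  qed
  then have "\<eta> \<in> subshift A" by (simp add: subshift_def)
  with 1 3 show ?thesis by blast
qed

text \<open>However fast \<open>p\<close> grows, the largest \<open>j \<le> i\<close> with
  \<open>p j \<le> i\<close> tends to infinity with \<open>i\<close>. Inserting 0 keeps the maximum
  defined, so the bound starts at \<open>i = p 0\<close>.\<close>

lemma slow_reparametrization:
  fixes p :: "nat \<Rightarrow> nat"
  shows "\<exists>\<phi>. filterlim \<phi> at_top sequentially \<and> (\<forall>\<^sub>F i in sequentially. p (\<phi> i) \<le> i)"
proof -
  define \<phi> where "\<phi> i = Max (insert 0 {j. j \<le> i \<and> p j \<le> i})" for i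
  have fin: "finite (insert 0 {j. j \<le> i \<and> p j \<le> i})" for i by simp
  have "\<forall>\<^sub>F i in sequentially. c \<le> \<phi> i" for c
    using fin by (intro eventually_sequentiallyI[of "max c (p c)"]) (auto simp: \<phi>_def intro!: Max_ge)
  moreover have "p (\<phi> i) \<le> i" if "p 0 \<le> i" for i
    using Max_in[OF fin[of i]] that unfolding \<phi>_def[symmetric] by auto
  ultimately show ?thesis
    by (intro exI[of _ \<phi>]) (auto simp: filterlim_at_top intro: eventually_sequentiallyI[of "p 0"])
qed

section \<open>Loops with prescribed information\<close>

context quasi_bernoulli
begin

definition info_loops :: "nat \<Rightarrow> nat \<Rightarrow> real \<Rightarrow> real \<Rightarrow> nat list set" where
  "info_loops a n x e =
     {pref n \<omega> | \<omega>. \<omega> \<in> subshift A \<and> \<omega> 0 = a \<and> \<omega> n = a \<and> \<bar>cyl_info A \<mu> n \<omega> - x\<bar> \<le> e}"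

lemma info_loops_subset: "info_loops a n x e \<subseteq> loop_words A a n"
  by (auto simp: info_loops_def loop_words_def)

lemma finite_info_loops: "finite (info_loops a n x e)"
  by (rule finite_subset[OF _ finite_words[of n A]]) (auto simp: info_loops_def)

text \<open>A word is preceded by a path of length \<open>k\<close> from \<open>z 0\<close> and
  followed by one back to \<open>z 0\<close>. It can be read off in the middle, so this is
  injective. The two paths have information at most \<open>D\<close> each and the two junctions cost
  \<open>K\<close> each, whence \<open>2 * (D + K)\<close>.\<close>

lemma card_info_words_le_loops:
  assumes paths: "paths_of_length A k" and z: "z \<in> subshift A"
  shows "\<exists>C\<ge>0. \<forall>n x e. card (info_words A \<mu> n x e) \<le> card (info_loops (z 0) (n + 2 * k) x (e + C))"
proof -
  obtain D where D: "0 \<le> D" "\<And>\<omega>. \<omega> \<in> subshift A \<Longrightarrow> cyl_info A \<mu> k \<omega> \<le> D"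
    using cyl_info_bounded[of k] by blast
  have "card (info_words A \<mu> n x e) \<le> card (info_loops (z 0) (n + 2 * k) x (e + 2 * (D + K)))" for n x e
  proof -
    have "\<exists>\<eta>. pref (n + 2 * k) \<eta> \<in> info_loops (z 0) (n + 2 * k) x (e + 2 * (D + K)) \<and>
        take n (drop k (pref (n + 2 * k) \<eta>)) = p" if "p \<in> info_words A \<mu> n x e" for p
    proof -
      obtain \<omega> where \<omega>: "\<omega> \<in> subshift A" "p = pref n \<omega>" "\<bar>cyl_info A \<mu> n \<omega> - x\<bar> \<le> e"
        using \<open>p \<in> info_words A \<mu> n x e\<close> by (auto simp: info_words_def)
      obtain \<eta>1 where \<eta>1: "\<eta>1 \<in> subshift A" "\<eta>1 0 = z 0" "\<And>t. \<eta>1 (k + t) = \<omega> t"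
        using subshift_glue[OF paths z \<omega>(1), of 0] by auto
      obtain \<eta> where \<eta>: "\<eta> \<in> subshift A" "\<And>t. t \<le> k + n \<Longrightarrow> \<eta> t = \<eta>1 t" "\<And>t. \<eta> (k + n + k + t) = z t"
        using subshift_glue[OF paths \<eta>1(1) z, of "k + n"] by auto
      have mid: "\<eta> (k + t) = \<omega> t" if "t < n" for t using that \<eta>(2)[of "k + t"] \<eta>1(3) by simp
      have "n + 2 * k = k + n + k + 0" by simp
      then have "\<eta> (n + 2 * k) = z 0" using \<eta>(3)[of 0] by presburger
      moreover have "\<eta> 0 = z 0" using \<eta>(2)[of 0] \<eta>1(2) by simp
      moreover have "\<bar>cyl_info A \<mu> (n + 2 * k) \<eta> - x\<bar> \<le> e + 2 * (D + K)"
      proof -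
        let ?\<eta>' = "(shift ^^ k) \<eta>"
        have \<eta>': "?\<eta>' \<in> subshift A" by (rule funpow_shift_in_subshift[OF \<eta>(1)])
        have "cyl_info A \<mu> n ?\<eta>' = cyl_info A \<mu> n \<omega>"
          by (rule cyl_info_cong) (simp add: pref_eq_iff funpow_shift mid)
        moreover have "\<bar>cyl_info A \<mu> (n + 2 * k) \<eta> - cyl_info A \<mu> k \<eta> - cyl_info A \<mu> (n + k) ?\<eta>'\<bar> \<le> K"
          using quasi_additive[OF \<eta>(1), of k "n + k"] by (simp add: mult_2 add_ac)
        moreover note quasi_additive[OF \<eta>', of n k] D(2)[OF \<eta>(1)] cyl_info_nonneg[OF \<eta>(1), of k]
          D(2)[OF funpow_shift_in_subshift[OF \<eta>', of n]]
          cyl_info_nonneg[OF funpow_shift_in_subshift[OF \<eta>', of n], of k] \<omega>(3)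
        ultimately show ?thesis by (simp add: abs_le_iff)
      qed
      ultimately have "pref (n + 2 * k) \<eta> \<in> info_loops (z 0) (n + 2 * k) x (e + 2 * (D + K))"
        using \<eta>(1) unfolding info_loops_def by blast
      moreover have "take n (drop k (pref (n + 2 * k) \<eta>)) = p"
        by (rule nth_equalityI) (auto simp: \<omega>(2) mid)
      ultimately show ?thesis by blast
    qed
    then have "\<forall>p\<in>info_words A \<mu> n x e. \<exists>q. q \<in> info_loops (z 0) (n + 2 * k) x (e + 2 * (D + K)) \<and>
        take n (drop k q) = p" by blast
    from bchoice[OF this] obtain h where
      h: "\<And>p. p \<in> info_words A \<mu> n x e \<Longrightarrow> h p \<in> info_loops (z 0) (n + 2 * k) x (e + 2 * (D + K))"
      "\<And>p. p \<in> info_words A \<mu> n x e \<Longrightarrow> take n (drop k (h p)) = p" by blast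
    have "inj_on h (info_words A \<mu> n x e)"
      by (rule inj_on_inverseI[where g = "\<lambda>q. take n (drop k q)"]) (rule h(2))
    then show ?thesis using h(1) finite_info_loops by (intro card_inj_on_le) auto
  qed
  with D(1) K_nonneg show ?thesis by (intro exI[of _ "2 * (D + K)"]) auto
qed

lemma many_info_loops:
  assumes paths: "paths_of_length A k" and z: "z \<in> subshift A" and st: "0 \<le> t" "t < s"
    and many: "\<And>\<epsilon> n0. 0 < \<epsilon> \<Longrightarrow> \<exists>n\<ge>n0.
      exp (s * real n) \<le> real (card (info_words A \<mu> n (\<alpha> * real n) (\<epsilon> * real n)))"
    and "0 < \<epsilon>"
  shows "\<exists>n\<ge>n0. exp (t * real n) \<le> real (card (info_loops (z 0) n (\<alpha> * real n) (\<epsilon> * real n)))"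
proof -
  obtain C where C: "0 \<le> C"
    "\<And>n x e. card (info_words A \<mu> n x e) \<le> card (info_loops (z 0) (n + 2 * k) x (e + C))"
    using card_info_words_le_loops[OF paths z] by blast
  \<comment> \<open>Beyond \<open>n1\<close> the gap between \<open>s\<close> and \<open>t\<close>
    pays for the additional length 2k; beyond \<open>n2\<close> half of the tolerance pays for
    \<open>C\<close> and for moving the centre from \<alpha> n to \<alpha> (n + 2k).\<close>
  obtain n1 :: nat where n1: "2 * real k * t / (s - t) \<le> real n1" using real_arch_simple by blast
  obtain n2 :: nat where n2: "(C + 2 * real k * \<bar>\<alpha>\<bar>) / (\<epsilon> / 2) \<le> real n2" using real_arch_simple by blast
  obtain n where n: "n \<ge> max n0 (max n1 n2)"
    and card: "exp (s * real n) \<le> real (card (info_words A \<mu> n (\<alpha> * real n) (\<epsilon> / 2 * real n)))"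
    using many[of "\<epsilon> / 2" "max n0 (max n1 n2)"] \<open>0 < \<epsilon>\<close> by auto
  let ?l = "n + 2 * k"
  have "2 * real k * t / (s - t) \<le> real n" using n1 n by simp
  then have "2 * real k * t \<le> (s - t) * real n" using st by (simp add: field_simps)
  then have "exp (t * real ?l) \<le> exp (s * real n)" by (simp add: algebra_simps)
  also note card
  also have "real (card (info_words A \<mu> n (\<alpha> * real n) (\<epsilon> / 2 * real n)))
      \<le> real (card (info_loops (z 0) ?l (\<alpha> * real n) (\<epsilon> / 2 * real n + C)))"
    using C(2) by simp
  also have "\<dots> \<le> real (card (info_loops (z 0) ?l (\<alpha> * real ?l) (\<epsilon> * real ?l)))"
  proof -
    have "(C + 2 * real k * \<bar>\<alpha>\<bar>) / (\<epsilon> / 2) \<le> real n" using n2 n by simp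
    then have 1: "C + 2 * real k * \<bar>\<alpha>\<bar> \<le> \<epsilon> / 2 * real n" using \<open>0 < \<epsilon>\<close> by (simp add: field_simps)
    have 2: "\<bar>\<alpha> * real ?l - \<alpha> * real n\<bar> \<le> 2 * real k * \<bar>\<alpha>\<bar>" by (simp add: algebra_simps abs_mult)
    have 3: "\<epsilon> * real n \<le> \<epsilon> * real ?l" using \<open>0 < \<epsilon>\<close> by simp
    have "\<bar>y - \<alpha> * real ?l\<bar> \<le> \<epsilon> * real ?l" if "\<bar>y - \<alpha> * real n\<bar> \<le> \<epsilon> / 2 * real n + C" for y
      using that 1 2 3 by linarith
    then have "info_loops (z 0) ?l (\<alpha> * real n) (\<epsilon> / 2 * real n + C)
        \<subseteq> info_loops (z 0) ?l (\<alpha> * real ?l) (\<epsilon> * real ?l)"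
      unfolding info_loops_def by blast
    then show ?thesis using finite_info_loops by (simp add: card_mono)
  qed
  finally show ?thesis using n by (intro exI[of _ ?l]) auto
qed

end

context quasi_bernoulli
begin

text \<open>Independent uniformly chosen loops give every cylinder of large length n mass at most
  \<open>exp (- t * real n)\<close>, because fixing n symbols fixes all complete blocks among
  them.\<close>

lemma level_set_entropy_ge:
  assumes paths: "paths_of_length A k" and st: "0 \<le> t" "t < s"
    and many: "\<And>\<epsilon> n0. 0 < \<epsilon> \<Longrightarrow> \<exists>n\<ge>n0.
      exp (s * real n) \<le> real (card (info_words A \<mu> n (\<alpha> * real n) (\<epsilon> * real n)))"
  shows "t \<le> bowen_entropy A (level_set A \<mu> \<alpha>)"
proof -
  \<comment> \<open>Passing from words to loops lowers the rate from \<open>s\<close> to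
    \<open>s'\<close>; the unfinished last block lowers it from \<open>s'\<close> to
    \<open>t\<close>.\<close>
  define s' where "s' = (s + t) / 2"
  have s': "t < s'" "s' < s" "0 \<le> s'" using st by (simp_all add: s'_def)
  obtain z where z: "z \<in> subshift A" using not_empty space_eq by auto
  define a where "a = z 0"
  \<comment> \<open>The lower bound on the length lets the tolerance 1 / (j + 1) per symbol absorb
    the error \<open>K\<close> of one seam; the summand 1 makes blocks nonempty.\<close>
  have "\<forall>j. \<exists>n. nat \<lceil>K * real (Suc j)\<rceil> + 1 \<le> n \<and> exp (s' * real n) \<le>
      real (card (info_loops a n (\<alpha> * real n) (inverse (real (Suc j)) * real n)))"
    unfolding a_def
    using many_info_loops[OF paths z s'(3,2) many, of "inverse (real (Suc _))"] by fastforce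
  from choice[OF this] obtain p where p: "\<And>j. nat \<lceil>K * real (Suc j)\<rceil> + 1 \<le> p j"
    and p_card: "\<And>j. exp (s' * real (p j)) \<le>
      real (card (info_loops a (p j) (\<alpha> * real (p j)) (inverse (real (Suc j)) * real (p j))))"
    by blast
  have p_pos: "0 < p j" for j using p[of j] by simp
  have K_le: "K \<le> inverse (real (Suc j)) * real (p j)" for j
  proof -
    have "K * real (Suc j) \<le> real (p j)" using p[of j] by linarith
    then show ?thesis by (simp add: field_simps del: of_nat_Suc)
  qed
  obtain \<phi> where \<phi>: "filterlim \<phi> at_top sequentially"
    and \<phi>_slow: "\<forall>\<^sub>F i in sequentially. Suc (\<phi> i) * p (\<phi> i) \<le> i"
    using slow_reparametrization[of "\<lambda>j. Suc j * p j"] by blast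
  define l where "l i = p (\<phi> i)" for i
  define e where "e i = inverse (real (Suc (\<phi> i)))" for i
  define V where "V i = info_loops a (l i) (\<alpha> * real (l i)) (e i * real (l i))" for i
  let ?T = "block_start l"
  have l: "0 < l i" for i by (simp add: l_def p_pos)
  have e: "e \<longlonglongrightarrow> 0"
    unfolding e_def by (rule filterlim_compose[OF LIMSEQ_inverse_real_of_nat \<phi>])
  have slow: "(\<lambda>i. real (l i) / real (?T i)) \<longlonglongrightarrow> 0"
  proof (rule Lim_null_comparison[OF _ e])
    show "\<forall>\<^sub>F i in sequentially. norm (real (l i) / real (?T i)) \<le> e i"
      using \<phi>_slow
    proof eventually_elim
      case (elim i)
      then have "real (Suc (\<phi> i) * l i) \<le> real (?T i)"
        unfolding l_def[symmetric] using block_start_ge[of l i] l by (simp only: of_nat_le_iff) simp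
      then have "real (Suc (\<phi> i)) * real (l i) \<le> real (?T i)" by (simp only: of_nat_mult)
      moreover have "0 < real (Suc (\<phi> i)) * real (l i)" using l by simp
      ultimately have "0 < real (?T i)" "real (Suc (\<phi> i)) * real (l i) \<le> real (?T i)" by linarith+
      then show ?case by (simp add: e_def field_simps del: of_nat_Suc)
    qed
  qed
  have V_card: "exp (s' * real (l i)) \<le> real (card (V i))" for i
    using p_card[of "\<phi> i"] by (simp only: V_def l_def e_def)
  have V: "finite (V i)" "V i \<noteq> {}" for i
  proof -
    show "finite (V i)" unfolding V_def by (rule finite_info_loops)
    have "0 < real (card (V i))" using V_card[of i] exp_gt_zero[of "s' * real (l i)"] by linarith
    then show "V i \<noteq> {}" by auto
  qed
  define M where "M i = uniform_count_measure (V i)" for i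
  interpret P: product_prob_space M UNIV
    unfolding product_prob_space_def product_prob_space_axioms_def product_sigma_finite_def M_def
    using V prob_space_uniform_count_measure prob_space_imp_sigma_finite by blast
  have space_P: "space (Pi\<^sub>M UNIV M) = {x. \<forall>i. x i \<in> V i}"
    by (auto simp: space_PiM M_def space_uniform_count_measure PiE_iff)
  have V_len: "length w = l i" if "w \<in> V i" for w i
    using that by (auto simp: V_def info_loops_def)
  have in_level: "concat_blocks l x \<in> level_set A \<mu> \<alpha>" if x: "x \<in> space (Pi\<^sub>M UNIV M)" for x
  proof (rule concat_blocks_in_level_set[OF l])
    have xV: "x i \<in> V i" for i using x space_P by auto
    show "x i \<in> loop_words A a (l i)" for i
      using xV[of i] info_loops_subset unfolding V_def by blast
    show "(\<lambda>i. 2 * e i) \<longlonglongrightarrow> 0" using tendsto_mult_right_zero[OF e, of 2] by simp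
    show "(\<lambda>i. real (l i) / real (?T i)) \<longlonglongrightarrow> 0" by (rule slow)
    fix i \<omega> assume \<omega>: "\<omega> \<in> subshift A" "pref (l i) \<omega> = x i"
    obtain \<eta> where \<eta>: "x i = pref (l i) \<eta>"
      "\<bar>cyl_info A \<mu> (l i) \<eta> - \<alpha> * real (l i)\<bar> \<le> e i * real (l i)"
      using xV[of i] by (auto simp: V_def info_loops_def)
    have "cyl_info A \<mu> (l i) \<omega> = cyl_info A \<mu> (l i) \<eta>"
      using \<omega>(2) \<eta>(1) by (intro cyl_info_cong) simp
    moreover have "K \<le> e i * real (l i)" using K_le[of "\<phi> i"] by (simp only: e_def l_def)
    ultimately show "\<bar>cyl_info A \<mu> (l i) \<omega> - \<alpha> * real (l i)\<bar> + K \<le> 2 * e i * real (l i)"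
      using \<eta>(2) by simp
  qed
  \<comment> \<open>Equivalently t (T + l) \<le> s' T for block start T and block length l: the
    complete blocks carry enough choices to cover the unfinished one.\<close>
  have "\<forall>\<^sub>F b in sequentially. t * real (l b) \<le> (s' - t) * real (?T b)"
  proof -
    have "(\<lambda>b. t * (real (l b) / real (?T b))) \<longlonglongrightarrow> 0" by (rule tendsto_mult_right_zero[OF slow])
    then have "\<forall>\<^sub>F b in sequentially. t * (real (l b) / real (?T b)) < s' - t"
      by (rule order_tendstoD(2)) (use s' in simp)
    then have "\<forall>\<^sub>F b in sequentially. t * (real (l b) / real (?T b)) < s' - t \<and> 1 \<le> b"
      by (intro eventually_conj eventually_ge_at_top)
    then show ?thesis
    proof eventually_elim
      case (elim b)
      then have "0 < real (?T b)" using block_start_ge[of l b] l by simp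
      with elim show ?case by (simp add: divide_less_eq)
    qed
  qed
  then have "\<forall>\<^sub>F n in sequentially. t * real (l (block_index l n))
      \<le> (s' - t) * real (?T (block_index l n))"
    using filterlim_block_index[of l] l by (auto intro: eventually_compose_filterlim)
  then obtain n0 where n0: "\<And>n. n \<ge> n0 \<Longrightarrow> t * real (l (block_index l n))
      \<le> (s' - t) * real (?T (block_index l n))"
    by (auto simp: eventually_sequentially)
  have mass: "\<exists>D\<in>sets (Pi\<^sub>M UNIV M). {x \<in> space (Pi\<^sub>M UNIV M). concat_blocks l x \<in> cylinder A n \<omega>} \<subseteq> D \<and>
      emeasure (Pi\<^sub>M UNIV M) D \<le> ennreal (exp (- t * real n))"
    if n: "n \<ge> n0" for n \<omega>
  proof (cases "{x \<in> space (Pi\<^sub>M UNIV M). concat_blocks l x \<in> cylinder A n \<omega>} = {}")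
    case True
    then show ?thesis by (intro bexI[of _ "{}"]) auto
  next
    case False
    then obtain x0 where x0: "\<And>i. x0 i \<in> V i" "concat_blocks l x0 \<in> cylinder A n \<omega>"
      using space_P by auto
    define b where "b = block_index l n"
    have b: "?T b \<le> n" "n \<le> ?T b + l b" using block_index_bounds[of l n] l by (simp_all add: b_def)
    \<comment> \<open>Any code \<open>x0\<close> whose sequence lies in the cylinder fixes the first
      \<open>b\<close> coordinates of all others; \<open>D\<close> forgets the constraint of the
      unfinished block.\<close>
    define D where "D = {x \<in> space (Pi\<^sub>M UNIV M). \<forall>i\<in>{..<b}. x i \<in> {x0 i}}"
    have D_em: "emeasure (Pi\<^sub>M UNIV M) D = (\<Prod>i<b. emeasure (M i) {x0 i})"
      unfolding D_def using x0(1)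
      by (intro P.emeasure_PiM_Collect) (auto simp: M_def sets_uniform_count_measure)
    also have "\<dots> = (\<Prod>i<b. ennreal (1 / real (card (V i))))"
      using V x0(1) by (intro prod.cong refl) (simp add: M_def emeasure_uniform_count_measure)
    also have "\<dots> = ennreal (\<Prod>i<b. 1 / real (card (V i)))" by (rule prod_ennreal) simp
    also have "\<dots> \<le> ennreal (exp (- t * real n))"
    proof (rule ennreal_leI)
      have "(\<Prod>i<b. 1 / real (card (V i))) \<le> (\<Prod>i<b. exp (- (s' * real (l i))))"
        using V_card
        by (intro prod_mono) (auto simp: exp_minus divide_inverse intro!: le_imp_inverse_le)
      also have "\<dots> = exp (- (s' * real (?T b)))"
        by (simp add: exp_sum[symmetric] sum_negf sum_distrib_left block_start_def)
      also have "\<dots> \<le> exp (- t * real n)"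
      proof -
        have "t * real n \<le> t * real (?T b + l b)" using b st by (intro mult_left_mono) auto
        also have "\<dots> \<le> s' * real (?T b)" using n0[OF n] by (simp add: b_def algebra_simps)
        finally show ?thesis by simp
      qed
      finally show "(\<Prod>i<b. 1 / real (card (V i))) \<le> exp (- t * real n)" .
    qed
    finally have D_le: "emeasure (Pi\<^sub>M UNIV M) D \<le> ennreal (exp (- t * real n))" .
    have "x \<in> D" if x: "x \<in> space (Pi\<^sub>M UNIV M)" "concat_blocks l x \<in> cylinder A n \<omega>" for x
    proof -
      have "x i = x0 i" if i: "i < b" for i
      proof (rule nth_equalityI)
        have len: "length (x i) = l i" "length (x0 i) = l i" using x(1) x0(1) V_len space_P by auto
        then show "length (x i) = length (x0 i)" by simp
        fix u assume "u < length (x i)"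
        then have u: "u < l i" using len by simp
        have "?T i + u < ?T (Suc i)" using u by simp
        also have "\<dots> \<le> ?T b" using i by (intro block_start_mono) simp
        finally have "?T i + u < n" using b by simp
        then have "concat_blocks l x (?T i + u) = concat_blocks l x0 (?T i + u)"
          using x(2) x0(2) by (auto simp: cylinder_def)
        then show "x i ! u = x0 i ! u"
          using concat_blocks_nth[of u l i x] concat_blocks_nth[of u l i x0] u by simp
      qed
      with x(1) show ?thesis by (simp add: D_def)
    qed
    moreover have "D \<in> sets (Pi\<^sub>M UNIV M)"
    proof -
      have "D = (\<Inter>i\<in>{..<b}. {x \<in> space (Pi\<^sub>M UNIV M). x i \<in> {x0 i}}) \<inter> space (Pi\<^sub>M UNIV M)"
        by (auto simp: D_def)
      moreover have "{x \<in> space (Pi\<^sub>M UNIV M). x i \<in> {x0 i}} \<in> sets (Pi\<^sub>M UNIV M)" for i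
      proof -
        have "(\<lambda>x. x i) -` {x0 i} \<inter> space (Pi\<^sub>M UNIV M) \<in> sets (Pi\<^sub>M UNIV M)"
          using x0(1)
          by (intro measurable_sets[OF measurable_component_singleton])
            (auto simp: M_def sets_uniform_count_measure)
        also have "(\<lambda>x. x i) -` {x0 i} \<inter> space (Pi\<^sub>M UNIV M)
            = {x \<in> space (Pi\<^sub>M UNIV M). x i \<in> {x0 i}}" by auto
        finally show ?thesis .
      qed
      ultimately show ?thesis by (cases "b = 0") (auto intro!: sets.Int sets.finite_INT)
    qed
    ultimately show ?thesis using D_le by (intro bexI[of _ D]) auto
  qed
  show ?thesis
    unfolding bowen_entropy_eq
  proof (rule cInf_greatest[OF level_set_exponents_nonempty])
    fix r assume "r \<in> bowen_exponents A (level_set A \<mu> \<alpha>)"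
    then show "t \<le> r"
      using mass_distribution_principle[OF P.P.prob_space_axioms in_level mass] by blast
  qed
qed

end

section \<open>From Gibbs measures to equality of the spectra\<close>

text \<open>The information is n P minus a Birkhoff sum up to \<open>ln C\<close>, and that
  expression is exactly additive along orbits. The bound is applied at \<open>n\<close>,
  \<open>m\<close> and \<open>n + m\<close>, which gives \<open>3 * ln C\<close>.\<close>

lemma quasi_bernoulli_if_gibbs:
  assumes "gibbs_measure A f \<mu>"
  shows "\<exists>K. quasi_bernoulli \<mu> A K"
proof -
  from assms obtain C P where "invariant_prob A \<mu>" and C: "0 < C"
    and gibbs: "\<And>\<omega> n. \<omega> \<in> subshift A \<Longrightarrow> 1 \<le> n \<Longrightarrow>
      inverse C \<le> measure \<mu> (cylinder A n \<omega>) / exp (- real n * P + (\<Sum>k<n. f ((shift ^^ k) \<omega>))) \<and>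
      measure \<mu> (cylinder A n \<omega>) / exp (- real n * P + (\<Sum>k<n. f ((shift ^^ k) \<omega>))) \<le> C"
    unfolding gibbs_measure_def Let_def by blast
  then have prob: "prob_space \<mu>" and sets: "sets \<mu> = sets (subshift_borel A)"
    by (auto simp: invariant_prob_def)
  interpret prob_space \<mu> by (rule prob)
  have "space \<mu> = subshift A" using sets_eq_imp_space_eq[OF sets] by (simp add: space_subshift_borel)
  then have cyl0: "measure \<mu> (cylinder A 0 \<omega>) = 1" for \<omega> using prob_space by (simp add: cylinder_0)
  let ?S = "\<lambda>n \<omega>. \<Sum>k<n. f ((shift ^^ k) \<omega>)"
  have pos: "0 < measure \<mu> (cylinder A n \<omega>)" if "\<omega> \<in> subshift A" for n \<omega>
  proof (cases "n = 0")
    case False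
    have "0 < inverse C" using C by simp
    also have "\<dots> \<le> measure \<mu> (cylinder A n \<omega>) / exp (- real n * P + ?S n \<omega>)"
      using gibbs[OF that, of n] False by simp
    finally show ?thesis by (simp add: zero_less_divide_iff)
  qed (simp add: cyl0)
  have info: "\<bar>cyl_info A \<mu> n \<omega> - (real n * P - ?S n \<omega>)\<bar> \<le> ln C" if "\<omega> \<in> subshift A" "1 \<le> n" for n \<omega>
  proof -
    define r where "r = measure \<mu> (cylinder A n \<omega>) / exp (- real n * P + ?S n \<omega>)"
    have r: "inverse C \<le> r" "r \<le> C" using gibbs[OF that] by (simp_all add: r_def)
    have "0 < r" using r(1) C by (meson inverse_positive_iff_positive less_le_trans)
    have "ln (inverse C) \<le> ln r" "ln r \<le> ln C" using r C \<open>0 < r\<close> by (simp_all add: ln_mono)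
    moreover have "ln r = - cyl_info A \<mu> n \<omega> - (- real n * P + ?S n \<omega>)"
      unfolding r_def using pos[OF that(1), of n] by (simp add: ln_div cyl_info_def)
    ultimately show ?thesis using C by (simp add: ln_inverse abs_le_iff)
  qed
  have lnC: "0 \<le> ln C"
  proof -
    obtain \<omega> where "\<omega> \<in> subshift A" using not_empty \<open>space \<mu> = subshift A\<close> by auto
    from info[OF this, of 1] show ?thesis by linarith
  qed
  have "quasi_bernoulli \<mu> A (3 * ln C)"
  proof unfold_locales
    fix \<omega> n m assume \<omega>: "\<omega> \<in> subshift A"
    have \<omega>': "(shift ^^ n) \<omega> \<in> subshift A" by (rule funpow_shift_in_subshift[OF \<omega>])
    show "\<bar>cyl_info A \<mu> (n + m) \<omega> - cyl_info A \<mu> n \<omega> - cyl_info A \<mu> m ((shift ^^ n) \<omega>)\<bar> \<le> 3 * ln C"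
    \<comment> \<open>The Gibbs bound starts at length 1. Length 0 is settled by the whole space
      having measure 1.\<close>
    proof (cases "n = 0 \<or> m = 0")
      case True
      then show ?thesis using lnC by (auto simp: cyl_info_def cyl0)
    next
      case False
      have "?S (n + m) \<omega> = ?S n \<omega> + ?S m ((shift ^^ n) \<omega>)"
        by (induction m) (simp_all add: funpow_shift add_ac)
      then show ?thesis
        using info[OF \<omega>, of "n + m"] info[OF \<omega>, of n] info[OF \<omega>', of m] False
        by (simp add: distrib_right abs_le_iff)
    qed
  qed (use sets pos in auto)
  then show ?thesis ..
qed

text \<open>If the first entropy were larger, the covering bound would force many words for \<mu>;
  the word count transfers them to \<nu>, where loops turn them back into entropy.\<close>

lemma entropy_spectrum_le_if_isomorphic:
  assumes \<mu>: "quasi_bernoulli \<mu> A K" and \<nu>: "quasi_bernoulli \<nu> A L"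
    and iso: "isomorphic_systems A \<mu> \<nu>" and paths: "paths_of_length A k"
  shows "entropy_spectrum A \<mu> \<alpha> \<le> entropy_spectrum A \<nu> \<alpha>"
proof (rule ccontr)
  interpret M: quasi_bernoulli \<mu> A K by (rule \<mu>)
  interpret N: quasi_bernoulli \<nu> A L by (rule \<nu>)
  define h where "h = entropy_spectrum A \<nu> \<alpha>"
  define h' where "h' = entropy_spectrum A \<mu> \<alpha>"
  assume "\<not> entropy_spectrum A \<mu> \<alpha> \<le> entropy_spectrum A \<nu> \<alpha>"
  then have hh': "h < h'" by (simp add: h_def h'_def)
  have h0: "0 \<le> h" unfolding h_def entropy_spectrum_def bowen_entropy_eq
    by (rule cInf_greatest[OF level_set_exponents_nonempty]) (simp add: bowen_exponents_def)
  \<comment> \<open>The gap is spent in quarters: the covering bound gives rate h + 3d for \<mu>,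
    the factor \<open>exp K\<close> reduces it to h + 2d for \<nu>, and closing up loops to h + d,
    still above h.\<close>
  define d where "d = (h' - h) / 4"
  have d: "0 < d" using hh' by (simp add: d_def)
  have "4 * d = h' - h" by (simp add: d_def)
  then have h': "h' = h + 4 * d" by simp
  have many_\<mu>: "\<exists>n\<ge>n0. exp ((h + 3 * d) * real n) < real (card (info_words A \<mu> n (\<alpha> * real n) (\<epsilon> * real n)))"
    if "0 < \<epsilon>" for \<epsilon> n0
  proof (rule ccontr)
    assume "\<not> ?thesis"
    then have "h + 7 / 2 * d \<in> bowen_exponents A (level_set A \<mu> \<alpha>)"
      using that h0 d by (intro level_set_exponents[of \<epsilon> _ "h + 3 * d" n0]) (auto simp: not_less)
    from bowen_entropy_le[OF this] show False
      using d h' by (simp add: h'_def entropy_spectrum_def)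
  qed
  have many_\<nu>: "\<exists>n\<ge>n0. exp ((h + 2 * d) * real n) \<le> real (card (info_words A \<nu> n (\<alpha> * real n) (\<epsilon> * real n)))"
    if eps: "0 < \<epsilon>" for \<epsilon> n0
  proof -
    obtain n1 :: nat where n1: "(K + L) / (\<epsilon> / 2) \<le> real n1" using real_arch_simple by blast
    obtain n2 :: nat where n2: "K / d \<le> real n2" using real_arch_simple by blast
    obtain n where n: "n \<ge> max n0 (max n1 n2)"
      "exp ((h + 3 * d) * real n) < real (card (info_words A \<mu> n (\<alpha> * real n) (\<epsilon> / 2 * real n)))"
      using many_\<mu>[of "\<epsilon> / 2" "max n0 (max n1 n2)"] eps by auto
    have "(K + L) / (\<epsilon> / 2) \<le> real n" using n1 n(1) by simp
    then have 1: "K + L \<le> \<epsilon> / 2 * real n" using eps by (simp add: field_simps)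
    have "K / d \<le> real n" using n2 n(1) by simp
    then have 2: "K \<le> d * real n" using d by (simp add: field_simps)
    have "info_words A \<nu> n (\<alpha> * real n) (\<epsilon> / 2 * real n + K + L) \<subseteq> info_words A \<nu> n (\<alpha> * real n) (\<epsilon> * real n)"
      using 1 by (force simp: info_words_def)
    then have "real (card (info_words A \<nu> n (\<alpha> * real n) (\<epsilon> / 2 * real n + K + L)))
        \<le> real (card (info_words A \<nu> n (\<alpha> * real n) (\<epsilon> * real n)))"
      using finite_info_words by (simp add: card_mono)
    then have "exp K * real (card (info_words A \<nu> n (\<alpha> * real n) (\<epsilon> / 2 * real n + K + L)))
        \<le> exp K * real (card (info_words A \<nu> n (\<alpha> * real n) (\<epsilon> * real n)))"
      by (intro mult_left_mono) auto
    then have 3: "exp ((h + 3 * d) * real n)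
        \<le> exp K * real (card (info_words A \<nu> n (\<alpha> * real n) (\<epsilon> * real n)))"
      using n(2) card_info_words_le_if_isomorphic[OF \<mu> \<nu> iso, of n "\<alpha> * real n" "\<epsilon> / 2 * real n"]
      by linarith
    have "exp K * exp ((h + 2 * d) * real n) \<le> exp ((h + 3 * d) * real n)"
      using 2 by (simp add: exp_add[symmetric] algebra_simps)
    also note 3
    finally have "exp ((h + 2 * d) * real n) \<le> real (card (info_words A \<nu> n (\<alpha> * real n) (\<epsilon> * real n)))"
      by simp
    with n(1) show ?thesis by auto
  qed
  have "h + d \<le> bowen_entropy A (level_set A \<nu> \<alpha>)"
    using h0 d many_\<nu> by (intro N.level_set_entropy_ge[OF paths, of _ "h + 2 * d"]) auto
  then show False using d by (simp add: h_def entropy_spectrum_def)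
qed

lemma isomorphic_systems_sym:
  assumes "isomorphic_systems A \<mu> \<nu>"
  shows "isomorphic_systems A \<nu> \<mu>"
proof -
  obtain X Y \<Phi> where X: "X \<in> sets (subshift_borel A)" and Y: "Y \<in> sets (subshift_borel A)"
    and bij: "bij_betw \<Phi> X Y"
    and sh: "shift ` X \<subseteq> X" "shift ` Y \<subseteq> Y" and one: "measure \<mu> X = 1" "measure \<nu> Y = 1"
    and \<Phi>: "\<Phi> \<in> measurable (restrict_space (subshift_borel A) X) (restrict_space (subshift_borel A) Y)"
    and \<Phi>': "inv_into X \<Phi> \<in>
          measurable (restrict_space (subshift_borel A) Y) (restrict_space (subshift_borel A) X)"
    and comm: "\<forall>\<omega>\<in>X. \<Phi> (shift \<omega>) = shift (\<Phi> \<omega>)"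
    and pres: "\<forall>B\<in>sets (subshift_borel A). B \<subseteq> X \<longrightarrow> measure \<mu> B = measure \<nu> (\<Phi> ` B)"
    using assms unfolding isomorphic_systems_def by (elim bexE exE conjE) (rule that; assumption)
  define \<Psi> where "\<Psi> = inv_into X \<Phi>"
  have bij': "bij_betw \<Psi> Y X" unfolding \<Psi>_def by (rule bij_betw_inv_into[OF bij])
  have \<Phi>\<Psi>: "\<Phi> (\<Psi> y) = y" if "y \<in> Y" for y
    unfolding \<Psi>_def by (rule bij_betw_inv_into_right[OF bij that])
  have \<Psi>\<Phi>: "\<Psi> (\<Phi> x) = x" if "x \<in> X" for x
    unfolding \<Psi>_def by (rule bij_betw_inv_into_left[OF bij that])
  have \<Psi>X: "\<Psi> y \<in> X" if "y \<in> Y" for y using bij' that by (auto simp: bij_betw_def)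
  have \<Phi>Y: "\<Phi> x \<in> Y" if "x \<in> X" for x using bij that by (auto simp: bij_betw_def)
  have inv: "inv_into Y \<Psi> x = \<Phi> x" if "x \<in> X" for x
    using inv_into_f_f[of \<Psi> Y "\<Phi> x"] bij' \<Phi>Y[OF that] \<Psi>\<Phi>[OF that] by (simp add: bij_betw_def)
  have sub: "X \<subseteq> subshift A" "Y \<subseteq> subshift A"
    using X Y by (metis sets.sets_into_space space_subshift_borel)+
  \<comment> \<open>The inverse of \<open>\<Psi>\<close> agrees with \<open>\<Phi>\<close> on
    \<open>X\<close> only, so measurability is transferred by congruence on the restricted
    space.\<close>
  have "inv_into Y \<Psi> \<in> measurable (restrict_space (subshift_borel A) X) (restrict_space (subshift_borel A) Y)"
    using \<Phi> by (subst measurable_cong[where g = \<Phi>]) (auto simp: space_restrict_space inv)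
  moreover have "\<Psi> (shift y) = shift (\<Psi> y)" if "y \<in> Y" for y
  proof -
    have "shift (\<Psi> y) \<in> X" using \<Psi>X[OF that] sh by auto
    then have "shift (\<Psi> y) = \<Psi> (\<Phi> (shift (\<Psi> y)))" using \<Psi>\<Phi> by simp
    also have "\<dots> = \<Psi> (shift y)" using comm \<Psi>X[OF that] \<Phi>\<Psi>[OF that] by simp
    finally show ?thesis by simp
  qed
  moreover have "measure \<nu> B = measure \<mu> (\<Psi> ` B)" if B: "B \<in> sets (subshift_borel A)" "B \<subseteq> Y" for B
  proof -
    have "\<Phi> -` B \<inter> space (restrict_space (subshift_borel A) X) \<in> sets (restrict_space (subshift_borel A) X)"
      using B Y by (intro measurable_sets[OF \<Phi>]) (auto simp: sets_restrict_space_iff space_subshift_borel)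
    also have "\<Phi> -` B \<inter> space (restrict_space (subshift_borel A) X) = \<Psi> ` B"
    proof (intro equalityI subsetI)
      fix x assume "x \<in> \<Phi> -` B \<inter> space (restrict_space (subshift_borel A) X)"
      then have "\<Phi> x \<in> B" "x \<in> X" by (auto simp: space_restrict_space)
      then show "x \<in> \<Psi> ` B" using \<Psi>\<Phi> by force
    next
      fix x assume "x \<in> \<Psi> ` B"
      then show "x \<in> \<Phi> -` B \<inter> space (restrict_space (subshift_borel A) X)"
        using B(2) \<Phi>\<Psi> \<Psi>X sub by (auto simp: space_restrict_space space_subshift_borel subset_iff)
    qed
    finally have "\<Psi> ` B \<in> sets (subshift_borel A)"
      using X by (simp add: sets_restrict_space_iff space_subshift_borel)
    moreover have "\<Psi> ` B \<subseteq> X" using B(2) \<Psi>X by auto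
    moreover have "\<Phi> ` \<Psi> ` B = B" using B(2) \<Phi>\<Psi> by (force simp: image_image)
    ultimately show ?thesis using pres by metis
  qed
  ultimately show ?thesis
    unfolding isomorphic_systems_def
    using X Y bij' sh one \<Phi>'[folded \<Psi>_def]
    by (intro bexI[OF _ Y] bexI[OF _ X] exI[of _ \<Psi>] conjI ballI impI)
qed

theorem theorem1p4:
  fixes N :: nat and A :: "nat mat" and f g :: "(nat \<Rightarrow> nat) \<Rightarrow> real"
    and \<mu>\<^sub>f \<mu>\<^sub>g :: "(nat \<Rightarrow> nat) measure"
  assumes "N \<ge> 2" and "A \<in> carrier_mat N N" and "zero_one_mat A" and "aperiodic_mat A"
    and "holder_continuous A f" and "holder_continuous A g"
    and "gibbs_measure A f \<mu>\<^sub>f" and "gibbs_measure A g \<mu>\<^sub>g"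
    and "isomorphic_systems A \<mu>\<^sub>f \<mu>\<^sub>g"
  shows "entropy_spectrum A \<mu>\<^sub>f = entropy_spectrum A \<mu>\<^sub>g"
proof
  fix \<alpha>
  obtain k where k: "paths_of_length A k"
    using paths_of_length_if_aperiodic[OF assms(2-4)] by blast
  obtain K where K: "quasi_bernoulli \<mu>\<^sub>f A K" using quasi_bernoulli_if_gibbs[OF assms(7)] by blast
  obtain L where L: "quasi_bernoulli \<mu>\<^sub>g A L" using quasi_bernoulli_if_gibbs[OF assms(8)] by blast
  show "entropy_spectrum A \<mu>\<^sub>f \<alpha> = entropy_spectrum A \<mu>\<^sub>g \<alpha>"
    using entropy_spectrum_le_if_isomorphic[OF K L assms(9) k]
      entropy_spectrum_le_if_isomorphic[OF L K isomorphic_systems_sym[OF assms(9)] k]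
    by (rule antisym)
qed

end
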